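(* Any purely infinite $C^*$-algebra $A$ is of type III.
   Context: Purely infinite (Kirchberg--Rørdam): for $a\in M_n(A)$ and $b\in M_m(A)$, write $a\precsim b$ relative to $M_{m,n}(A)$ if there is a sequence $\{x_k\}_{k\in\mathbb N}$ in $M_{m,n}(A)$ with $\|x_k^*bx_k-a\|\to 0$. An element $a\in A$ is properly infinite if $a\oplus a\precsim a$ relative to $M_{1,2}(A)$. $A$ is purely infinite if every element of $A_+$ is properly infinite. Type III (Cuntz--Pedersen): an element $x\in A_+$ is finite if for every sequence $\{z_k\}_{k\in\mathbb N}$ in $A$ with $x=\sum_{k=1}^\infty z_k^*z_k$, the condition $\sum_{k=1}^\infty z_kz_k^*\le x$ implies $x=\sum_{k=1}^\infty z_kz_k^*$ (series converging in norm). $A$ is of type III if it has no non-zero finite elements. *)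

theory Defs
  imports "HOL-Analysis.Analysis"
begin

text \<open>Complex C*-algebras, not necessarily unital; the zero algebra is allowed.\<close>

class cstar_algebra = real_normed_algebra + banach +
  fixes scaleC :: "complex \<Rightarrow> 'a \<Rightarrow> 'a" (infixr "*\<^sub>C" 75)
    and adj :: "'a \<Rightarrow> 'a" ("_\<^sup>\<star>" [1000] 999)
  assumes scaleR_scaleC: "r *\<^sub>R x = complex_of_real r *\<^sub>C x"
    and scaleC_add_right: "c *\<^sub>C (x + y) = c *\<^sub>C x + c *\<^sub>C y"
    and scaleC_add_left: "(c + d) *\<^sub>C x = c *\<^sub>C x + d *\<^sub>C x"
    and scaleC_scaleC: "c *\<^sub>C (d *\<^sub>C x) = (c * d) *\<^sub>C x"
    and scaleC_one: "1 *\<^sub>C x = x"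
    and mult_scaleC_left: "(c *\<^sub>C x) * y = c *\<^sub>C (x * y)"
    and mult_scaleC_right: "x * (c *\<^sub>C y) = c *\<^sub>C (x * y)"
    and norm_scaleC: "norm (c *\<^sub>C x) = cmod c * norm x"
    and adj_adj: "(x\<^sup>\<star>)\<^sup>\<star> = x"
    and adj_add: "(x + y)\<^sup>\<star> = x\<^sup>\<star> + y\<^sup>\<star>"
    and adj_scaleC: "(c *\<^sub>C x)\<^sup>\<star> = cnj c *\<^sub>C x\<^sup>\<star>"
    and adj_mult: "(x * y)\<^sup>\<star> = y\<^sup>\<star> * x\<^sup>\<star>"
    and cstar_identity: "norm (x\<^sup>\<star> * x) = (norm x)\<^sup>2"

definition positive_cone :: "'a::cstar_algebra set" where
  "positive_cone = {x. \<exists>y. x = y\<^sup>\<star> * y}"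

definition cstar_le :: "'a::cstar_algebra \<Rightarrow> 'a \<Rightarrow> bool" (infix "\<le>\<^sub>A" 50) where
  "x \<le>\<^sub>A y \<longleftrightarrow> y - x \<in> positive_cone"


text \<open>Matrices with \<open>m\<close> rows and \<open>n\<close> columns are elements of \<^typ>\<open>'a^'n^'m\<close>.
  The matrix product of the library requires entries in a unital semiring.\<close>

definition mat_mult :: "'a::cstar_algebra^'k^'m \<Rightarrow> 'a^'n^'k \<Rightarrow> 'a^'n^'m" (infixl "\<bullet>\<^sub>M" 70) where
  "X \<bullet>\<^sub>M Y = (\<chi> i j. \<Sum>k\<in>UNIV. X $ i $ k * Y $ k $ j)"

definition mat_adj :: "'a::cstar_algebra^'n^'m \<Rightarrow> 'a^'m^'n" where
  "mat_adj X = (\<chi> i j. (X $ j $ i)\<^sup>\<star>)"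

definition mat_vec :: "'a::cstar_algebra^'n^'m \<Rightarrow> 'a^'n \<Rightarrow> 'a^'m" where
  "mat_vec X v = (\<chi> i. \<Sum>j\<in>UNIV. X $ i $ j * v $ j)"

text \<open>The norm of the Hilbert \<open>A\<close>-module \<open>A\<^sup>n\<close> with inner product
  \<open>\<langle>v, w\<rangle> = \<Sum>\<^sub>j v\<^sub>j\<^sup>\<star> w\<^sub>j\<close>.\<close>

definition vec_norm :: "'a::cstar_algebra^'n \<Rightarrow> real" where
  "vec_norm v = sqrt (norm (\<Sum>j\<in>UNIV. (v $ j)\<^sup>\<star> * v $ j))"

text \<open>\<open>M\<^sub>n(A)\<close> acts faithfully by adjointable operators on \<open>A\<^sup>n\<close>, so the operator norm is its unique
  C*-norm. The norm that the library puts on \<^typ>\<open>'a^'n^'n\<close> is only equivalent to it.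
  The supremum is over a bounded non-empty set.\<close>

definition mat_norm :: "'a::cstar_algebra^'n^'m \<Rightarrow> real" where
  "mat_norm X = (SUP v\<in>{v. vec_norm v \<le> 1}. vec_norm (mat_vec X v))"


definition cuntz_below :: "'a::cstar_algebra^'n^'n \<Rightarrow> 'a^'m^'m \<Rightarrow> bool" (infix "\<precsim>" 50) where
  "a \<precsim> b \<longleftrightarrow>
    (\<exists>x :: nat \<Rightarrow> 'a^'n^'m. (\<lambda>k. mat_norm (mat_adj (x k) \<bullet>\<^sub>M b \<bullet>\<^sub>M x k - a)) \<longlonglongrightarrow> 0)"

definition mat1 :: "'a \<Rightarrow> 'a^1^1" where
  "mat1 a = (\<chi> i j. a)"

definition oplus :: "'a::zero \<Rightarrow> 'a \<Rightarrow> 'a^2^2" (infixl "\<oplus>" 65) where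
  "a \<oplus> b = (\<chi> i j. if i \<noteq> j then 0 else if i = 1 then a else b)"

definition properly_infinite :: "'a::cstar_algebra \<Rightarrow> bool" where
  "properly_infinite a \<longleftrightarrow> a \<oplus> a \<precsim> mat1 a"

text \<open>Properties of the whole algebra are stated with a type argument.\<close>

definition purely_infinite :: "'a::cstar_algebra itself \<Rightarrow> bool" where
  "purely_infinite _ \<longleftrightarrow> (\<forall>a \<in> (positive_cone :: 'a set). properly_infinite a)"

text \<open>Finiteness in the sense of Cuntz and Pedersen; meant for \<open>x\<close> positive.\<close>

definition cp_finite :: "'a::cstar_algebra \<Rightarrow> bool" where
  "cp_finite x \<longleftrightarrow>
    (\<forall>(z :: nat \<Rightarrow> 'a) y.
      (\<lambda>k. (z k)\<^sup>\<star> * z k) sums x \<longrightarrow> (\<lambda>k. z k * (z k)\<^sup>\<star>) sums y \<longrightarrow> y \<le>\<^sub>A x \<longrightarrow> x = y)"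

definition type_III :: "'a::cstar_algebra itself \<Rightarrow> bool" where
  "type_III _ \<longleftrightarrow> \<not> (\<exists>x \<in> (positive_cone :: 'a set). x \<noteq> 0 \<and> cp_finite x)"

end

(* Let x = b b with b self-adjoint and norm b < 1. Continuous functional calculus writes x as a norm
   convergent sum of d_k d_k, where d_k is supported away from 0, so that cutoffs e_k, e'_k of b with
   e_k d_k = d_k and e'_k e_k = e_k exist and e'_k is divisible by b. Proper infiniteness of e_k e_k
   provides n almost orthogonal copies of it; spreading d_k d_k evenly over them, and absorbing the error
   in one more element, gives d_k d_k as a finite sum of z* z with the sum of z z* as small as we like,
   of order n^(-1/2). Since z = e'_k z, this small sum is b t_k b with t_k small. Adding up, x is
   equivalent to b T b with norm T <= 1/2, which lies below x and has at most half its norm.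

   Everything is done without a unit: functions of a self-adjoint h act on the algebra by left
   multiplication, and f(h) is itself an element when f 0 = 0. *)

theory Submission
  imports Defs "HOL-Computational_Algebra.Polynomial"
begin

text \<open>Finiteness is about exact equalities, whereas proper infiniteness only approximates.
  Hence the copies are scaled slightly too small: the slack left over dominates the error, so that
  the remainder is an honest square. Slicing \<open>x\<close> is forced by the division by
  \<open>b\<close>. A cutoff that vanishes near 0 is \<open>b * v\<close> for some \<open>v\<close>,
  but the bound on \<open>v\<close> worsens as the cutoff moves towards 0, so each slice receives
  its own tolerance, chosen after its \<open>v\<close> is known. The exponent -1/2 comes from
  squaring a sum: n almost orthogonal elements of squared norm about 1/n give a sum Y of the
  products z z* for which Y Y has about n relevant terms of size 1/n^2. The axioms mention neither
  spectrum nor order. The sup norm bound for functions of \<open>h\<close> is therefore obtained by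
  writing \<open>h\<close> as the real part of an isometry and reading off Fourier coefficients.
  Positivity is defined by products y* y, so Kaplansky's argument is required before any element of
  the cone can be written as \<open>b * b\<close>, and before matrix entries can be bounded by the
  matrix norm.\<close>

lemma adj_zero [simp]: "0\<^sup>\<star> = (0::'a::cstar_algebra)"
  using adj_add[of 0 "0::'a"] by simp

lemma adj_minus: "(- x)\<^sup>\<star> = - (x\<^sup>\<star>)" for x :: "'a::cstar_algebra"
  using adj_add[of x "-x"] by (simp add: eq_neg_iff_add_eq_0 add.commute)

lemma adj_diff: "(x - y)\<^sup>\<star> = x\<^sup>\<star> - y\<^sup>\<star>" for x :: "'a::cstar_algebra"
  using adj_add[of x "-y"] by (simp add: adj_minus)

lemma adj_scaleR: "(r *\<^sub>R x)\<^sup>\<star> = r *\<^sub>R x\<^sup>\<star>" for x :: "'a::cstar_algebra"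
  by (simp add: scaleR_scaleC adj_scaleC)

lemma norm_adj [simp]: "norm (x\<^sup>\<star>) = norm x" for x :: "'a::cstar_algebra"
proof -
  have le: "norm y \<le> norm (y\<^sup>\<star>)" for y :: 'a
  proof (cases "y = 0")
    case False
    have "norm y * norm y \<le> norm (y\<^sup>\<star>) * norm y"
      using norm_mult_ineq[of "y\<^sup>\<star>" y] by (simp add: cstar_identity power2_eq_square)
    then show ?thesis using False by simp
  qed simp
  show ?thesis using le[of x] le[of "x\<^sup>\<star>"] by (simp add: adj_adj)
qed

lemma bounded_linear_adj: "bounded_linear (adj :: 'a::cstar_algebra \<Rightarrow> 'a)"
  by (rule bounded_linear_intro[of _ 1]) (auto simp: adj_add adj_scaleR)

lemmas tendsto_adj = bounded_linear.tendsto[OF bounded_linear_adj]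
lemmas adj_sum = linear_sum[OF bounded_linear.linear[OF bounded_linear_adj]]

lemma norm_adj_mult_self: "norm (x\<^sup>\<star> * x) = norm x * norm x" for x :: "'a::cstar_algebra"
  by (simp add: cstar_identity power2_eq_square)

lemma norm_square_selfadj: "x\<^sup>\<star> = x \<Longrightarrow> norm (x * x) = norm x * norm x" for x :: "'a::cstar_algebra"
  using norm_adj_mult_self[of x] by simp

text \<open>Left multiplication is faithful by the C*-identity, tested on
  \<open>a = (x - y)\<^sup>\<star>\<close>. This replaces evaluation at a unit wherever an element
  is known only through its action.\<close>

lemma eq_if_mult_eq:
  fixes x y :: "'a::cstar_algebra"
  assumes "\<And>a. x * a = y * a"
  shows "x = y"
proof -
  have "((x - y)\<^sup>\<star>)\<^sup>\<star> * (x - y)\<^sup>\<star> = 0"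
    using assms[of "(x - y)\<^sup>\<star>"] by (simp add: adj_adj left_diff_distrib)
  then show ?thesis
    using norm_adj_mult_self[of "(x - y)\<^sup>\<star>"] by simp
qed

lemma scaleC_zero_right [simp]: "c *\<^sub>C 0 = (0::'a::cstar_algebra)"
  using scaleC_add_right[of c 0 "0::'a"] by simp

lemma scaleC_minus_right: "c *\<^sub>C (- x) = - (c *\<^sub>C (x::'a::cstar_algebra))"
  using scaleC_add_right[of c x "-x"] by (simp add: eq_neg_iff_add_eq_0 add.commute)

lemma scaleC_minus_left: "(- c) *\<^sub>C x = - (c *\<^sub>C (x::'a::cstar_algebra))"
proof -
  have "0 *\<^sub>C x = 0" using scaleR_scaleC[of 0 x] by simp
  then show ?thesis
    using scaleC_add_left[of c "-c" x] by (simp add: eq_neg_iff_add_eq_0 add.commute)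
qed

lemma scaleC_diff_right: "c *\<^sub>C (x - y) = c *\<^sub>C x - c *\<^sub>C (y::'a::cstar_algebra)"
  using scaleC_add_right[of c x "-y"] by (simp add: scaleC_minus_right)

text \<open>The element \<open>q\<close> plays the role of \<open>1 - (1 - t)\<^sup>1\<^sup>/\<^sup>2\<close>, so that no unit is needed.\<close>

lemma sqrt_one_minus_exists:
  fixes t :: "'a::cstar_algebra"
  assumes t: "t\<^sup>\<star> = t" "norm t < 1"
  obtains q where "q\<^sup>\<star> = q" "q + q = t + q * q" "norm q \<le> 1"
    "\<And>b. b * t = t * b \<Longrightarrow> b * q = q * b" "\<And>e. e * t = t \<Longrightarrow> e * q = q"
proof -
  \<comment> \<open>The iteration sends \<open>q\<close> to half of \<open>t + q * q\<close>. On the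
    ball of radius \<rho> its values have norm at most (\<rho>^2 + \<rho>^2) / 2 \<le> \<rho>, and
    its Lipschitz constant there is \<rho> < 1.\<close>
  define \<rho> where "\<rho> = sqrt (norm t)"
  have \<rho>: "0 \<le> \<rho>" "\<rho> < 1" "\<rho> * \<rho> = norm t" using t by (auto simp: \<rho>_def)
  have \<rho>2: "norm t \<le> \<rho>" using mult_right_le_one_le[of \<rho> \<rho>] \<rho> by simp
  \<comment> \<open>Every property wanted of the fixed point is a closed condition preserved by the
    iteration, so all of them are put into the complete set on which it runs.\<close>
  define S where "S = {q. norm q \<le> \<rho>} \<inter> {q. q\<^sup>\<star> = q} \<inter> (\<Inter>b\<in>{b. b * t = t * b}. {q. b * q = q * b})
    \<inter> (\<Inter>e\<in>{e. e * t = t}. {q. e * q = q})"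
  define f where "f q = (1/2) *\<^sub>R (t + q * q)" for q
  have "closed S" unfolding S_def
    by (intro closed_Int closed_INT ballI closed_Collect_eq closed_Collect_le continuous_intros
        bounded_linear.continuous_on[OF bounded_linear_adj])
  then have S1: "complete S" by (simp add: complete_eq_closed)
  have "0 \<in> S" using \<rho> by (auto simp: S_def)
  then have S2: "S \<noteq> {}" by blast
  have S3: "f ` S \<subseteq> S"
  proof
    fix y assume "y \<in> f ` S"
    then obtain q where q: "q \<in> S" and y: "y = f q" by auto
    have nq: "norm q \<le> \<rho>" and sq: "q\<^sup>\<star> = q" using q unfolding S_def by blast+
    have "norm (q * q) \<le> \<rho> * \<rho>"
      using norm_mult_ineq[of q q] mult_mono[OF nq nq] \<rho> by simp
    then have "norm (t + q * q) \<le> \<rho> + \<rho>" using norm_triangle_ineq[of t "q * q"] \<rho> \<rho>2 by linarith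
    then have 1: "norm y \<le> \<rho>" by (simp add: y f_def)
    have 2: "y\<^sup>\<star> = y" by (simp add: y f_def adj_scaleR adj_add adj_mult t sq)
    have 3: "b * y = y * b" if "b * t = t * b" for b
    proof -
      have bq: "b * q = q * b" using q that unfolding S_def by blast
      have "b * (q * q) = q * q * b" by (metis bq mult.assoc)
      then show ?thesis by (simp add: y f_def distrib_left distrib_right that)
    qed
    have 4: "e * y = y" if "e * t = t" for e
    proof -
      have eq: "e * q = q" using q that unfolding S_def by blast
      have "e * (q * q) = q * q" by (metis eq mult.assoc)
      then show ?thesis by (simp add: y f_def distrib_left that)
    qed
    show "y \<in> S" unfolding S_def using 1 2 3 4 by blast
  qed
  have S4: "dist (f p) (f q) \<le> \<rho> * dist p q" if "p \<in> S" "q \<in> S" for p q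
  proof -
    have n: "norm p \<le> \<rho>" "norm q \<le> \<rho>" using that unfolding S_def by blast+
    have "f p - f q = (1/2) *\<^sub>R (p * (p - q) + (p - q) * q)"
      by (simp add: f_def algebra_simps)
    then have "norm (f p - f q) = (1/2) * norm (p * (p - q) + (p - q) * q)" by simp
    also have "\<dots> \<le> (1/2) * (norm p * norm (p - q) + norm (p - q) * norm q)"
      by (intro mult_left_mono order.trans[OF norm_triangle_ineq] add_mono norm_mult_ineq) auto
    also have "\<dots> \<le> (1/2) * (\<rho> * norm (p - q) + norm (p - q) * \<rho>)"
      by (intro mult_left_mono add_mono mult_right_mono n) auto
    finally show ?thesis by (simp add: dist_norm)
  qed
  obtain q where q: "q \<in> S" "f q = q"
    using Banach_fix[OF S1 S2 \<rho>(1,2) S3 S4] by blast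
  have "q + q = 2 *\<^sub>R f q" using q by (simp add: scaleR_2)
  then have "q + q = t + q * q" by (simp add: f_def)
  moreover have "norm q \<le> \<rho>" "q\<^sup>\<star> = q" using q(1) unfolding S_def by blast+
  moreover have "b * q = q * b" if "b * t = t * b" for b using q(1) that unfolding S_def by blast
  moreover have "e * q = q" if "e * t = t" for e using q(1) that unfolding S_def by blast
  moreover have "norm q \<le> 1" using \<open>norm q \<le> \<rho>\<close> \<rho>(2) by linarith
  ultimately show ?thesis using that[of q] by blast
qed

section \<open>Polynomials of a self-adjoint element\<close>

definition act :: "'a::cstar_algebra \<Rightarrow> real poly \<Rightarrow> 'a \<Rightarrow> 'a" where
  "act h p a = fold_coeffs (\<lambda>c r. c *\<^sub>R a + h * r) p 0"

lemma act_0 [simp]: "act h 0 a = 0" by (simp add: act_def)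

lemma act_pCons [simp]: "act h (pCons c p) a = c *\<^sub>R a + h * act h p a"
  by (cases "c = 0 \<and> p = 0") (auto simp: act_def)

lemma act_add: "act h (p + q) a = act h p a + act h q a"
  by (induction p q rule: poly_induct2) (auto simp: algebra_simps)

lemma act_smult: "act h (smult c p) a = c *\<^sub>R act h p a"
  by (induction p) (auto simp: algebra_simps)

lemma act_minus: "act h (- p) a = - act h p a"
  by (induction p) auto

lemma act_diff: "act h (p - q) a = act h p a - act h q a"
  using act_add[of h p "- q" a] by (simp add: act_minus)

lemma act_mult: "act h (p * q) a = act h p (act h q a)"
  by (induction p) (auto simp: act_add act_smult)

lemma act_mult_right: "act h p (a * b) = act h p a * b"
  by (induction p) (auto simp: algebra_simps)

lemma act_commute: "act h p (h * a) = h * act h p a"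
  by (induction p) (auto simp: algebra_simps)

lemma act_add_right: "act h p (a + b) = act h p a + act h p b"
  by (induction p) (auto simp: algebra_simps)

text \<open>Real coefficients make \<open>p(h)\<close> self-adjoint. Since \<open>p(h)\<close> may
  fail to be an element of the algebra, this is expressed through the pairing of \<open>x\<close>
  and \<open>y\<close> to \<open>x\<^sup>\<star> * y\<close>.\<close>

lemma adj_act:
  assumes "h\<^sup>\<star> = h"
  shows "(act h p a)\<^sup>\<star> * b = a\<^sup>\<star> * act h p b"
proof (induction p arbitrary: b)
  case (pCons c p)
  have "(act h (pCons c p) a)\<^sup>\<star> * b = c *\<^sub>R (a\<^sup>\<star> * b) + (act h p a)\<^sup>\<star> * (h * b)"
    by (simp add: adj_add adj_scaleR adj_mult assms distrib_right mult.assoc)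
  also have "\<dots> = a\<^sup>\<star> * act h (pCons c p) b"
    by (simp add: pCons.IH act_commute distrib_left)
  finally show ?case .
qed simp

text \<open>The Horner scheme of \<open>act\<close> with complex coefficients and an arbitrary
  operator. The isometry built from \<open>h\<close> involves a multiple of the identity and so is
  treated as an operator, not as left multiplication by an element.\<close>

definition cact :: "('a::cstar_algebra \<Rightarrow> 'a) \<Rightarrow> complex poly \<Rightarrow> 'a \<Rightarrow> 'a" where
  "cact T p a = fold_coeffs (\<lambda>c r. c *\<^sub>C a + T r) p 0"

lemma cact_0 [simp]: "cact T 0 a = 0" by (simp add: cact_def)

lemma scaleC_zero_left [simp]: "0 *\<^sub>C x = (0::'a::cstar_algebra)"
  using scaleR_scaleC[of 0 x] by simp

context
  fixes T :: "'a::cstar_algebra \<Rightarrow> 'a"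
  assumes T_add: "T (x + y) = T x + T y" and T_scaleC: "T (c *\<^sub>C x) = c *\<^sub>C T x"
begin

lemma T_0: "T 0 = 0" using T_add[of 0 0] by simp

lemma cact_pCons: "cact T (pCons c p) a = c *\<^sub>C a + T (cact T p a)"
  by (cases "c = 0 \<and> p = 0") (auto simp: cact_def T_0)

lemma cact_add: "cact T (p + q) a = cact T p a + cact T q a"
  by (induction p q rule: poly_induct2) 
    (auto simp: cact_pCons scaleC_add_left T_add)

lemma cact_smult: "cact T (smult c p) a = c *\<^sub>C cact T p a"
  by (induction p) (auto simp: cact_pCons scaleC_add_right scaleC_scaleC T_scaleC)

lemma cact_monom: "cact T (monom c n) a = c *\<^sub>C (T ^^ n) a"
  by (induction n) (auto simp: monom_0 monom_Suc cact_pCons T_scaleC T_0)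

lemma norm_cact_le:
  assumes "\<And>x. norm (T x) = norm x"
  shows "norm (cact T p a) \<le> (\<Sum>c\<leftarrow>coeffs p. cmod c) * norm a"
proof (induction p)
  case 0 then show ?case by (simp add: cact_def)
next
  case (pCons c p)
  have "norm (cact T (pCons c p) a) \<le> norm (c *\<^sub>C a) + norm (cact T p a)"
    using norm_triangle_ineq[of "c *\<^sub>C a" "T (cact T p a)"] assms by (simp add: cact_pCons)
  also have "\<dots> \<le> cmod c * norm a + (\<Sum>c\<leftarrow>coeffs p. cmod c) * norm a"
    using pCons.IH by (simp add: norm_scaleC)
  finally show ?case using pCons.hyps by (auto simp: cCons_def algebra_simps)
qed

end

section \<open>Coefficients of a complex polynomial and its values on the unit circle\<close>

lemma sum_root_unity_powers:
  fixes k m :: nat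
  assumes "0 < m" "\<not> m dvd k"
  shows "(\<Sum>l<m. cis (2 * pi * l / m) ^ k) = 0"
proof -
  define w where "w = cis (2 * pi * k / m)"
  have w: "w = cis (2 * pi / m) ^ k" unfolding w_def Complex.DeMoivre by (rule arg_cong[of _ _ cis]) simp
  have "w \<noteq> 1"
  proof
    assume "w = 1"
    then have "cos (2 * pi * k / m) = 1" by (simp add: w_def complex_eq_iff)
    then obtain n :: int where "2 * pi * k / m = n * 2 * pi" using cos_one_2pi_int by auto
    then have "real k = n * real m" using assms by (simp add: field_simps)
    then have "int k = n * int m" by (metis of_int_eq_iff of_int_mult of_int_of_nat_eq)
    then have "int m dvd int k" by simp
    then show False using assms by simp
  qed
  moreover have "w ^ m = 1"
  proof -
    have "w ^ m = cis (2 * pi * k)" unfolding w_def Complex.DeMoivre using assms by simp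
    then show ?thesis by (simp add: cis_multiple_2pi)
  qed
  moreover have "cis (2 * pi * l / m) ^ k = w ^ l" for l
    unfolding w_def Complex.DeMoivre by (rule arg_cong[of _ _ cis]) simp
  ultimately show ?thesis by (simp add: geometric_sum)
qed

text \<open>Discrete Fourier inversion: averaging \<open>z ^ (m - i) * poly G z\<close> over the
  \<open>m\<close>-th roots of unity isolates the coefficient of index \<open>i\<close>. The
  exponent \<open>m - i\<close> stands for \<open>-i\<close>, and taking \<open>m\<close> as the
  degree plus 1 keeps distinct indices distinct modulo \<open>m\<close>.\<close>

lemma coeff_le_circle_bound:
  fixes G :: "complex poly"
  assumes B: "\<And>z. cmod z = 1 \<Longrightarrow> cmod (poly G z) \<le> B"
  shows "cmod (coeff G i) \<le> B"
proof (cases "i \<le> degree G")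
  case False
  then show ?thesis using order.trans[OF norm_ge_zero B[of 1]] by (simp add: coeff_eq_0)
next
  case True
  define m where "m = Suc (degree G)"
  define z where "z l = cis (2 * pi * real l / m)" for l
  have "(\<Sum>l<m. z l ^ (m - i) * poly G (z l))
      = (\<Sum>l<m. \<Sum>j\<le>degree G. coeff G j * z l ^ (m - i + j))"
    by (simp add: poly_altdef sum_distrib_left power_add mult_ac)
  also have "\<dots> = (\<Sum>j\<le>degree G. coeff G j * (\<Sum>l<m. z l ^ (m - i + j)))"
    by (subst sum.swap) (simp add: sum_distrib_left)
  also have "\<dots> = (\<Sum>j\<le>degree G. if j = i then coeff G i * m else 0)"
  proof (rule sum.cong)
    fix j assume j: "j \<in> {..degree G}"
    show "coeff G j * (\<Sum>l<m. z l ^ (m - i + j)) = (if j = i then coeff G i * m else 0)"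
    proof (cases "j = i")
      case True
      have "z l ^ m = 1" for l
      proof -
        have "real m * (2 * pi * real l / m) = 2 * pi * l" by (simp add: m_def)
        then have "z l ^ m = cis (2 * pi * l)" unfolding z_def Complex.DeMoivre by (rule arg_cong)
        then show ?thesis by (simp add: cis_multiple_2pi)
      qed
      moreover have "m - i + j = m" using \<open>i \<le> degree G\<close> True by (simp add: m_def)
      ultimately show ?thesis using True by simp
    next
      case False
      have "\<not> m dvd (m - i + j)"
      proof
        assume "m dvd m - i + j"
        then obtain c where c: "m - i + j = m * c" by (auto elim: dvdE)
        have "0 < m - i + j" "m - i + j < 2 * m" using j \<open>i \<le> degree G\<close> by (auto simp: m_def)
        then have "0 < c" "c < 2" unfolding c by auto
        then have "c = 1" by simp
        then show False using c False j \<open>i \<le> degree G\<close> by (auto simp: m_def)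
      qed
      then show ?thesis using False sum_root_unity_powers[of m "m - i + j"] 
        by (simp add: z_def m_def)
    qed
  qed simp
  also have "\<dots> = coeff G i * m" using True by simp
  finally have eq: "(\<Sum>l<m. z l ^ (m - i) * poly G (z l)) = coeff G i * m" .
  have "cmod (coeff G i) * m = cmod (\<Sum>l<m. z l ^ (m - i) * poly G (z l))"
    by (simp add: eq norm_mult)
  also have "\<dots> \<le> (\<Sum>l<m. B)"
    by (rule sum_norm_le) (auto simp: norm_mult norm_power z_def intro!: B)
  finally show ?thesis by (simp add: m_def mult.commute)
qed

text \<open>If \<open>U\<close> is invertible and \<open>h\<close> acts as \<open>(U + U\<^sup>-\<^sup>1) / 2\<close>, then \<open>U\<^sup>d p(h)\<close> is a polynomial
  in \<open>U\<close>. Multiplying by \<open>U\<^sup>d\<close> avoids Laurent polynomials.\<close>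

lemma poly_of_average_on_circle:
  fixes U :: "'a::cstar_algebra \<Rightarrow> 'a"
  assumes U_add: "\<And>x y. U (x + y) = U x + U y" and U_scaleC: "\<And>c x. U (c *\<^sub>C x) = c *\<^sub>C U x"
    and U2: "\<And>b. U (h * b) = (1/2) *\<^sub>C (U (U b) + b)"
    and "degree p \<le> d"
  shows "\<exists>G. degree G \<le> 2 * d \<and> (\<forall>z. cmod z = 1 \<longrightarrow> poly G z = z ^ d * of_real (poly p (Re z))) \<and>
    (\<forall>a. (U ^^ d) (act h p a) = cact U G a)"
  using \<open>degree p \<le> d\<close>
proof (induction d arbitrary: p)
  case 0
  then obtain c where c: "p = [:c:]" by (auto elim: degree_eq_zeroE)
  show ?case
    by (rule exI[of _ "[:complex_of_real c:]"])
      (simp add: c scaleR_scaleC cact_pCons[OF U_add U_scaleC] T_0[of U, OF U_add U_scaleC])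
next
  case (Suc d)
  obtain c p' where p: "p = pCons c p'" by (cases p)
  have "degree p' \<le> d" using Suc.prems by (auto simp: p split: if_splits)
  then obtain G where G: "degree G \<le> 2 * d"
    "\<And>z. cmod z = 1 \<Longrightarrow> poly G z = z ^ d * of_real (poly p' (Re z))"
    "\<And>a. (U ^^ d) (act h p' a) = cact U G a"
    using Suc.IH by blast
  \<comment> \<open>On the circle z Re z = (z^2 + 1) / 2, which is also the rule \<open>U2\<close>
    for \<open>U (h * b)\<close>. One Horner step therefore multiplies by half of
    \<open>[:1,0,1:]\<close>, while the constant coefficient picks up the full power
    \<open>Suc d\<close>.\<close>
  define G' where "G' = monom (of_real c) (Suc d) + smult (1/2) ([:1,0,1:] * G)"
  have "degree ([:1,0,1:] * G) \<le> 2 + degree G"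
    by (rule order.trans[OF degree_mult_le]) simp
  then have "degree G' \<le> 2 * Suc d"
    unfolding G'_def using G(1) by (intro degree_add_le order.trans[OF degree_monom_le]
        order.trans[OF degree_smult_le]) auto
  moreover have "poly G' z = z ^ Suc d * of_real (poly p (Re z))" if z: "cmod z = 1" for z
  proof -
    have "z * cnj z = 1" using z complex_norm_square[of z] by simp
    moreover have "complex_of_real (Re z) = (z + cnj z) / 2" by (simp add: complex_add_cnj)
    ultimately have "z * of_real (Re z) = (z * z + 1) / 2" by (simp only: distrib_left times_divide_eq_right)
    have "z ^ Suc d * (of_real c + of_real (Re z) * P) = z ^ Suc d * of_real c + z ^ d * ((z * z + 1) / 2) * P" for P
    proof -
      have "z ^ Suc d * (of_real c + of_real (Re z) * P) = z ^ Suc d * of_real c + z ^ d * (z * of_real (Re z)) * P"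
        by (simp add: algebra_simps)
      with \<open>z * of_real (Re z) = (z * z + 1) / 2\<close> show ?thesis by (simp only:)
    qed
    moreover have "poly G' z = z ^ Suc d * of_real c + z ^ d * ((z * z + 1) / 2) * of_real (poly p' (Re z))"
      by (simp add: G'_def poly_monom G(2)[OF z] field_simps)
    ultimately show ?thesis by (simp add: p)
  qed
  moreover have "(U ^^ Suc d) (act h p a) = cact U G' a" for a
  proof -
    have add: "(U ^^ n) (x + y) = (U ^^ n) x + (U ^^ n) y" for n x y
      by (induction n) (auto simp: U_add)
    have scale: "(U ^^ n) (s *\<^sub>C x) = s *\<^sub>C (U ^^ n) x" for n s x
      by (induction n) (auto simp: U_scaleC)
    have comm: "(U ^^ n) (U x) = U ((U ^^ n) x)" for n x
      by (induction n) auto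
    note U_lin = U_add U_scaleC
    have "(U ^^ Suc d) (h * act h p' a) = (1/2) *\<^sub>C (U (U (cact U G a)) + cact U G a)"
      by (simp add: comm[symmetric] U2 add scale G(3)[symmetric])
    moreover have "cact U ([:1,0,1:] * G) a = U (U (cact U G a)) + cact U G a"
      by (simp add: cact_pCons[OF U_lin] cact_add[OF U_lin] cact_smult[OF U_lin] scaleC_one add.commute)
    ultimately show ?thesis
      by (simp add: p add scale scaleR_scaleC G'_def cact_add[OF U_lin] cact_smult[OF U_lin]
          cact_monom[OF U_lin] U_lin del: mult_pCons_left)
  qed
  ultimately show ?case by blast
qed

text \<open>The root of order 2^n of a factor linear in 2^n tends to 1. Concretely, if v < u then
  the ratio r = v / u makes (C 2^n + 1) r^(2^n) tend to 0, although it is always at least 1.\<close>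

lemma le_if_power_le_linear_times_power:
  fixes u v C :: real
  assumes "0 \<le> u" "0 \<le> v" and le: "\<And>n. u ^ (2 ^ n) \<le> (C * 2 ^ n + 1) * v ^ (2 ^ n)"
  shows "u \<le> v"
proof (rule ccontr)
  assume "\<not> u \<le> v"
  then have u: "0 < u" "v < u" using assms by auto
  define r where "r = v / u"
  have r: "0 \<le> r" "r < 1" using u assms by (auto simp: r_def)
  have le1: "1 \<le> C * (real (2 ^ n) * r ^ (2 ^ n)) + r ^ (2 ^ n)" for n
    using le[of n] u by (simp add: r_def power_divide field_simps)
  have sub: "filterlim (\<lambda>n. 2 ^ n :: nat) at_top sequentially"
    by (rule filterlim_subseq) (simp add: strict_mono_def)
  have "(\<lambda>n. real n * r ^ n) \<longlonglongrightarrow> 0" using powser_times_n_limit_0[of r] r by simp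
  from filterlim_compose[OF this sub]
  have 1: "(\<lambda>n. real (2 ^ n) * r ^ (2 ^ n)) \<longlonglongrightarrow> 0" .
  have "(\<lambda>n. r ^ n) \<longlonglongrightarrow> 0" using LIMSEQ_power_zero[of r] r by simp
  from filterlim_compose[OF this sub]
  have "(\<lambda>n. C * (real (2 ^ n) * r ^ (2 ^ n)) + r ^ (2 ^ n)) \<longlonglongrightarrow> C * 0 + 0"
    by (intro tendsto_intros 1)
  then have "1 \<le> C * 0 + (0::real)"
    by (rule LIMSEQ_le_const) (use le1 in blast)
  then show False by simp
qed

section \<open>Continuous functional calculus\<close>

text \<open>Fixing one approximating sequence with an explicit rate lets \<open>fcal\<close> be
  defined as a limit; \<open>fcal_tendsto\<close> then shows that any other uniform approximation
  gives the same value.\<close>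

definition papprox :: "(real \<Rightarrow> real) \<Rightarrow> nat \<Rightarrow> real poly" where
  "papprox f n = (SOME p. \<forall>t\<in>{-1..1}. \<bar>poly p t - f t\<bar> \<le> inverse (real (Suc n)))"

lemma Weierstrass_poly:
  assumes "continuous_on {-1..1} f" "0 < e"
  shows "\<exists>p. \<forall>t\<in>{-1..1::real}. \<bar>poly p t - f t\<bar> \<le> e"
proof -
  obtain g where g: "real_polynomial_function g" "\<And>t. t \<in> {-1..1} \<Longrightarrow> \<bar>f t - g t\<bar> < e"
    using Stone_Weierstrass_real_polynomial_function[OF compact_Icc assms] by blast
  obtain a n where "g = (\<lambda>x. \<Sum>i\<le>n. a i * x ^ i)"
    using real_polynomial_function_imp_sum[OF g(1)] by blast
  then have "poly (\<Sum>i\<le>n. monom (a i) i) t = g t" for t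
    by (simp add: poly_sum poly_monom)
  then show ?thesis using g(2) by (metis abs_minus_commute less_imp_le)
qed

lemma papprox:
  assumes "continuous_on {-1..1} f" "t \<in> {-1..1}"
  shows "\<bar>poly (papprox f n) t - f t\<bar> \<le> inverse (real (Suc n))"
  using someI_ex[OF Weierstrass_poly[OF assms(1)], of "inverse (real (Suc n))"] assms(2)
  unfolding papprox_def by simp

definition fcal :: "'a::cstar_algebra \<Rightarrow> (real \<Rightarrow> real) \<Rightarrow> 'a \<Rightarrow> 'a" where
  "fcal h f a = lim (\<lambda>n. act h (papprox f n) a)"

text \<open>Meaningful only for \<open>f\<close> continuous on \<open>{-1..1}\<close> with \<open>f 0 = 0\<close>.\<close>

definition el :: "'a::cstar_algebra \<Rightarrow> (real \<Rightarrow> real) \<Rightarrow> 'a" where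
  "el h f = (THE e. \<forall>a. e * a = fcal h f a)"

context
  fixes h :: "'a::cstar_algebra"
  assumes selfadj: "h\<^sup>\<star> = h" and contr: "norm h < 1"
begin

text \<open>Left multiplication by \<open>h\<close> is the real part of the isometry \<open>U = h + \<i> (1 - h\<^sup>2)\<^sup>1\<^sup>/\<^sup>2\<close>. The factor
  depending on the degree disappears on applying the bound to high powers of \<open>p\<close>.\<close>

lemma norm_act_le_degree:
  assumes "\<And>t. t \<in> {-1..1} \<Longrightarrow> \<bar>poly p t\<bar> \<le> M"
  shows "norm (act h p a) \<le> (2 * real (degree p) + 1) * M * norm a"
proof -
  have hh: "norm (h * h) < 1" "(h * h)\<^sup>\<star> = h * h"
    using mult_strict_mono[OF contr contr] norm_mult_ineq[of h h] by (simp_all add: adj_mult selfadj)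
  \<comment> \<open>Here \<open>1 - q\<close> plays the role of the square root of
    \<open>1 - h * h\<close>; \<open>q\<close> commutes with \<open>h\<close> because
    \<open>h\<close> commutes with its square.\<close>
  obtain q where q: "q\<^sup>\<star> = q" "q + q = h * h + q * q" "norm q \<le> 1"
    and qc: "\<And>b. b * (h * h) = h * h * b \<Longrightarrow> b * q = q * b" and "\<And>e. e * (h * h) = h * h \<Longrightarrow> e * q = q"
    by (rule sqrt_one_minus_exists[OF hh(2,1)], rule that)
  have hq: "h * (q * b) = q * (h * b)" for b
  proof -
    have "h * q = q * h" by (rule qc) (simp add: mult.assoc)
    then show ?thesis by (metis mult.assoc)
  qed
  have qq: "q * b + q * b = h * (h * b) + q * (q * b)" for b
    using arg_cong[OF q(2), of "\<lambda>z. z * b"] by (simp add: distrib_right mult.assoc)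
  define U where "U b = h * b + \<i> *\<^sub>C (b - q * b)" for b
  \<comment> \<open>\<open>V\<close> is the adjoint of \<open>U\<close>. Their product is h^2 + (1 -
    q)^2, which is the identity by the equation for \<open>q + q\<close>; with \<open>adj\<close>
    below this makes \<open>U\<close> isometric.\<close>
  define V where "V b = h * b - \<i> *\<^sub>C (b - q * b)" for b
  have lin: "U (x + y) = U x + U y" "U (c *\<^sub>C x) = c *\<^sub>C U x" for x y c
    by (simp_all add: U_def distrib_left scaleC_add_right scaleC_diff_right mult_scaleC_right scaleC_scaleC mult.commute)
  have i2: "\<i> *\<^sub>C \<i> *\<^sub>C x = - x" for x :: 'a
    using scaleC_scaleC[of \<i> \<i> x] scaleC_minus_left[of 1 x] by (simp add: scaleC_one)
  have VU: "V (U b) = b" for b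
  proof -
    have "V (U b) = h * (h * b) - (q * b + q * b) + q * (q * b) + b"
      by (simp add: U_def V_def distrib_left right_diff_distrib scaleC_add_right scaleC_diff_right
        mult_scaleC_right i2 hq)
    then show ?thesis by (simp add: qq)
  qed
  have avg: "h * b = (1/2) *\<^sub>C (U b + V b)" for b
  proof -
    have "(1/2) *\<^sub>C (U b + V b) = (1/2) *\<^sub>R (h * b + h * b)"
      by (simp add: U_def V_def scaleR_scaleC)
    also have "\<dots> = h * b" by (simp flip: scaleR_2)
    finally show ?thesis ..
  qed
  have hU: "U (h * b) = h * U b" for b
    by (simp add: U_def distrib_left right_diff_distrib mult_scaleC_right hq scaleC_diff_right)
  have UV: "U (h * b) = (1/2) *\<^sub>C (U (U b) + b)" for b
    using avg[of "U b"] by (simp add: hU VU)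
  have adj: "(U x)\<^sup>\<star> * y = x\<^sup>\<star> * V y" for x y
    by (simp add: U_def V_def adj_add adj_mult adj_scaleC adj_diff selfadj q(1) distrib_right
        right_diff_distrib left_diff_distrib mult_scaleC_left mult_scaleC_right scaleC_minus_left mult.assoc
        scaleC_diff_right)
  have iso: "norm (U x) = norm x" for x
  proof -
    have "(norm (U x))\<^sup>2 = (norm x)\<^sup>2"
      by (simp add: adj VU flip: cstar_identity)
    then show ?thesis by (rule power2_eq_imp_eq) auto
  qed
  have isod: "norm ((U ^^ n) x) = norm x" for n x
    by (induction n) (auto simp: iso)
  obtain G where G: "degree G \<le> 2 * degree p"
    "\<And>z. cmod z = 1 \<Longrightarrow> poly G z = z ^ degree p * of_real (poly p (Re z))"
    "(U ^^ degree p) (act h p a) = cact U G a"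
    using poly_of_average_on_circle[of U h p "degree p", OF lin UV] by blast
  \<comment> \<open>On the circle \<open>poly G z\<close> has the modulus of
    \<open>poly p (Re z)\<close>. The degree factor of the lemma merely counts the coefficients of
    \<open>G\<close>, at most 2 deg p + 1 of them.\<close>
  have M: "cmod (coeff G i) \<le> M" for i
  proof (rule coeff_le_circle_bound)
    fix z assume z: "cmod z = 1"
    then have "Re z \<in> {-1..1}" using abs_Re_le_cmod[of z] by auto
    then show "cmod (poly G z) \<le> M" using assms by (simp add: G(2) z norm_mult norm_power)
  qed
  have M0: "0 \<le> M" using order.trans[OF norm_ge_zero M] by simp
  have "norm (act h p a) = norm (cact U G a)" using isod[of "degree p" "act h p a"] G(3) by simp
  also have "\<dots> \<le> (\<Sum>c\<leftarrow>coeffs G. cmod c) * norm a"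
    by (rule norm_cact_le) (auto simp: lin iso)
  also have "\<dots> \<le> ((2 * real (degree p) + 1) * M) * norm a"
  proof (rule mult_right_mono)
    have "(\<Sum>c\<leftarrow>coeffs G. cmod c) \<le> (\<Sum>c\<leftarrow>coeffs G. M)"
      by (rule sum_list_mono) (auto simp: coeffs_def M split: if_splits)
    also have "\<dots> = length (coeffs G) * M" by (simp add: sum_list_triv)
    also have "\<dots> \<le> (2 * real (degree p) + 1) * M"
      using G(1) by (intro mult_right_mono M0) (auto simp: coeffs_def)
    finally show "(\<Sum>c\<leftarrow>coeffs G. cmod c) \<le> (2 * real (degree p) + 1) * M" .
  qed simp
  finally show ?thesis .
qed

text \<open>The C*-identity gives
  \<open>norm (act h r a) ^ 2 \<le> norm a * norm (act h (r * r) a)\<close>. Iterating this reaches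
  the power 2^n of \<open>p\<close>, where the degree factor is linear in 2^n but the sup bound is
  M^(2^n).\<close>

lemma norm_act_le:
  assumes M: "\<And>t. t \<in> {-1..1} \<Longrightarrow> \<bar>poly p t\<bar> \<le> M"
  shows "norm (act h p a) \<le> M * norm a"
proof (cases "a = 0")
  case True
  then show ?thesis using norm_act_le_degree[OF assms, of a] by simp
next
  case False
  have sq: "norm (act h r a) ^ 2 \<le> norm a * norm (act h (r * r) a)" for r
  proof -
    have "norm (act h r a) ^ 2 = norm ((act h r a)\<^sup>\<star> * act h r a)" by (simp add: cstar_identity)
    also have "\<dots> = norm (a\<^sup>\<star> * act h (r * r) a)" by (simp add: adj_act selfadj act_mult)
    also have "\<dots> \<le> norm a * norm (act h (r * r) a)" using norm_mult_ineq[of "a\<^sup>\<star>"] by simp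
    finally show ?thesis .
  qed
  have pow: "norm a * norm (act h p a) ^ (2 ^ n) \<le> norm a ^ (2 ^ n) * norm (act h (p ^ (2 ^ n)) a)" for n
  proof (induction n)
    case (Suc n)
    define y where "y = norm (act h (p ^ (2 ^ n)) a)"
    have "(norm a * norm (act h p a) ^ (2 ^ n)) ^ 2 \<le> (norm a ^ (2 ^ n) * y) ^ 2"
      using Suc.IH by (intro power_mono) (auto simp: y_def)
    also have "\<dots> = norm a ^ (2 ^ Suc n) * y ^ 2" by (simp add: power_mult_distrib mult.commute flip: power_mult)
    also have "\<dots> \<le> norm a ^ (2 ^ Suc n) * (norm a * norm (act h (p ^ (2 ^ Suc n)) a))"
      using sq[of "p ^ (2 ^ n)"] by (intro mult_left_mono) (auto simp: y_def power_add mult_2)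
    finally have "norm a * (norm a * norm (act h p a) ^ (2 ^ Suc n)) \<le>
        norm a * (norm a ^ (2 ^ Suc n) * norm (act h (p ^ (2 ^ Suc n)) a))"
      by (simp add: power_mult_distrib mult_ac power2_eq_square power_add mult_2)
    then show ?case by (rule mult_left_le_imp_le) (use False in simp)
  qed simp
  show ?thesis
  proof (rule le_if_power_le_linear_times_power)
    have "0 \<le> M" using order.trans[OF abs_ge_zero M[of 0]] by simp
    then show "0 \<le> M * norm a" by simp
    fix n
    have Mn: "\<bar>poly (p ^ (2 ^ n)) t\<bar> \<le> M ^ (2 ^ n)" if "t \<in> {-1..1}" for t
      using M[OF that] by (simp add: power_abs power_mono)
    have "norm (act h (p ^ (2 ^ n)) a) \<le> (2 * real (degree (p ^ (2 ^ n))) + 1) * M ^ (2 ^ n) * norm a"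
      by (rule norm_act_le_degree[OF Mn])
    also have "\<dots> \<le> (2 * real (degree p) * 2 ^ n + 1) * M ^ (2 ^ n) * norm a"
    proof -
      have "degree (p ^ (2 ^ n)) \<le> degree p * 2 ^ n" by (rule degree_power_le)
      then have "real (degree (p ^ (2 ^ n))) \<le> real (degree p * 2 ^ n)" by (simp only: of_nat_le_iff)
      then show ?thesis using \<open>0 \<le> M\<close> by (intro mult_right_mono) auto
    qed
    finally have "norm a ^ (2 ^ n) * norm (act h (p ^ (2 ^ n)) a) \<le>
       norm a ^ (2 ^ n) * ((2 * real (degree p) * 2 ^ n + 1) * M ^ (2 ^ n) * norm a)"
      by (rule mult_left_mono) simp
    with pow[of n] have "norm a * norm (act h p a) ^ (2 ^ n) \<le>
       norm a * ((2 * real (degree p) * 2 ^ n + 1) * (M * norm a) ^ (2 ^ n))"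
      by (simp add: power_mult_distrib mult_ac)
    then show "norm (act h p a) ^ (2 ^ n) \<le> (2 * real (degree p) * 2 ^ n + 1) * (M * norm a) ^ (2 ^ n)"
      by (rule mult_left_le_imp_le) (use False in simp)
  qed simp
qed

lemma norm_act_diff_le:
  assumes "\<And>t. t \<in> {-1..1} \<Longrightarrow> \<bar>poly p t - poly q t\<bar> \<le> M"
  shows "norm (act h p a - act h q a) \<le> M * norm a"
  using norm_act_le[of "p - q" M a] assms by (simp add: act_diff)

section \<open>From polynomials to continuous functions\<close>

lemma fcal_lim:
  assumes f: "continuous_on {-1..1} f"
  shows "(\<lambda>n. act h (papprox f n) a) \<longlonglongrightarrow> fcal h f a"
proof -
  have "Cauchy (\<lambda>n. act h (papprox f n) a)"
  proof (rule metric_CauchyI)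
    fix e :: real assume "0 < e"
    then have "0 < e / (2 * (norm a + 1))" by (simp add: add_nonneg_pos)
    from reals_Archimedean[OF this] obtain N where N: "inverse (real (Suc N)) < e / (2 * (norm a + 1))" ..
    have "dist (act h (papprox f m) a) (act h (papprox f n) a) < e" if "N \<le> m" "N \<le> n" for m n
    proof -
      have inv: "inverse (real (Suc m)) \<le> inverse (real (Suc N))"
        "inverse (real (Suc n)) \<le> inverse (real (Suc N))"
        using that by (auto simp: field_simps)
      have "norm (act h (papprox f m) a - act h (papprox f n) a) \<le> (2 * inverse (real (Suc N))) * norm a"
      proof (rule norm_act_diff_le)
        fix t :: real assume t: "t \<in> {-1..1}"
        show "\<bar>poly (papprox f m) t - poly (papprox f n) t\<bar> \<le> 2 * inverse (real (Suc N))"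
          using papprox[OF f t, of m] papprox[OF f t, of n] inv by linarith
      qed
      also have "\<dots> \<le> (2 * inverse (real (Suc N))) * (norm a + 1)" by (intro mult_left_mono) auto
      also have "\<dots> < e"
      proof -
        have "0 < 2 * (norm a + 1)" by (simp add: add_nonneg_pos)
        then have "inverse (real (Suc N)) * (2 * (norm a + 1)) < e" using N by (simp only: pos_less_divide_eq)
        then show ?thesis by (simp only: mult_ac)
      qed
      finally show ?thesis by (simp add: dist_norm)
    qed
    then show "\<exists>M. \<forall>m\<ge>M. \<forall>n\<ge>M. dist (act h (papprox f m) a) (act h (papprox f n) a) < e" by blast
  qed
  then show ?thesis
    unfolding fcal_def by (simp add: Cauchy_convergent_iff convergent_LIMSEQ_iff)
qed

lemma fcal_approx:
  assumes f: "continuous_on {-1..1} f" and p: "\<And>t. t \<in> {-1..1} \<Longrightarrow> \<bar>poly p t - f t\<bar> \<le> e"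
  shows "norm (act h p a - fcal h f a) \<le> e * norm a"
proof (rule LIMSEQ_le)
  show "(\<lambda>n. norm (act h p a - act h (papprox f n) a)) \<longlonglongrightarrow> norm (act h p a - fcal h f a)"
    by (intro tendsto_intros fcal_lim f)
  show "(\<lambda>n. (e + inverse (real (Suc n))) * norm a) \<longlonglongrightarrow> e * norm a"
    using tendsto_mult_right[OF tendsto_add[OF tendsto_const LIMSEQ_inverse_real_of_nat]] by fastforce
  have "norm (act h p a - act h (papprox f n) a) \<le> (e + inverse (real (Suc n))) * norm a" for n
  proof (rule norm_act_diff_le)
    fix t :: real assume t: "t \<in> {-1..1}"
    show "\<bar>poly p t - poly (papprox f n) t\<bar> \<le> e + inverse (real (Suc n))"
      using papprox[OF f t, of n] p[OF t] by linarith
  qed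
  then show "\<exists>N. \<forall>n\<ge>N. norm (act h p a - act h (papprox f n) a) \<le> (e + inverse (real (Suc n))) * norm a"
    by blast
qed

lemma fcal_poly: "fcal h (poly p) a = act h p a"
  using fcal_approx[of "poly p" p 0 a] by (simp add: continuous_intros)

lemma fcal_id: "fcal h (\<lambda>t. t) a = h * a"
proof -
  have "poly [:0,1:] = (\<lambda>t::real. t)" by (simp add: fun_eq_iff)
  then show ?thesis using fcal_poly[of "[:0,1:]" a] by simp
qed

lemma fcal_tendsto:
  assumes f: "continuous_on {-1..1} f"
    and p: "\<And>t n. t \<in> {-1..1} \<Longrightarrow> \<bar>poly (p n) t - f t\<bar> \<le> r n" and r: "r \<longlonglongrightarrow> 0"
  shows "(\<lambda>n. act h (p n) a) \<longlonglongrightarrow> fcal h f a"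
proof -
  have "(\<lambda>n. act h (p n) a - fcal h f a) \<longlonglongrightarrow> 0"
  proof (rule Lim_null_comparison)
    show "\<forall>\<^sub>F n in sequentially. norm (act h (p n) a - fcal h f a) \<le> r n * norm a"
      using fcal_approx[OF f p] by simp
    show "(\<lambda>n. r n * norm a) \<longlonglongrightarrow> 0" using tendsto_mult_right[OF r, of "norm a"] by simp
  qed
  then show ?thesis by (simp add: LIM_zero_iff)
qed

lemma norm_fcal_le:
  assumes f: "continuous_on {-1..1} f" and B: "\<And>t. t \<in> {-1..1} \<Longrightarrow> \<bar>f t\<bar> \<le> B"
  shows "norm (fcal h f a) \<le> B * norm a"
proof -
  have "norm (fcal h f a) = norm (act h 0 a - fcal h f a)" by simp
  also have "\<dots> \<le> B * norm a" by (rule fcal_approx[OF f]) (use B in simp)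
  finally show ?thesis .
qed

lemma fcal_add:
  assumes f: "continuous_on {-1..1} f" and g: "continuous_on {-1..1} g"
  shows "fcal h (\<lambda>t. f t + g t) a = fcal h f a + fcal h g a"
proof (rule LIMSEQ_unique)
  show "(\<lambda>n. act h (papprox f n + papprox g n) a) \<longlonglongrightarrow> fcal h (\<lambda>t. f t + g t) a"
  proof (rule fcal_tendsto)
    show "(\<lambda>n. 2 * inverse (real (Suc n))) \<longlonglongrightarrow> 0"
      using tendsto_mult_left[OF LIMSEQ_inverse_real_of_nat, of 2] by simp
    fix t :: real and n assume t: "t \<in> {-1..1}"
    show "\<bar>poly (papprox f n + papprox g n) t - (f t + g t)\<bar> \<le> 2 * inverse (real (Suc n))"
      using papprox[OF f t, of n] papprox[OF g t, of n] by (simp del: of_nat_Suc)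
  qed (intro continuous_intros f g)
  show "(\<lambda>n. act h (papprox f n + papprox g n) a) \<longlonglongrightarrow> fcal h f a + fcal h g a"
    unfolding act_add by (intro tendsto_intros fcal_lim f g)
qed

lemma fcal_mult:
  assumes f: "continuous_on {-1..1} f" and g: "continuous_on {-1..1} g"
  shows "fcal h (\<lambda>t. f t * g t) a = fcal h f (fcal h g a)"
proof (rule LIMSEQ_unique)
  obtain F where F: "\<And>t. t \<in> {-1..1} \<Longrightarrow> \<bar>f t\<bar> \<le> F"
    using compact_imp_bounded[OF compact_continuous_image[OF f compact_Icc]]
    by (metis bounded_iff image_eqI real_norm_def)
  obtain G where G: "\<And>t. t \<in> {-1..1} \<Longrightarrow> \<bar>g t\<bar> \<le> G"
    using compact_imp_bounded[OF compact_continuous_image[OF g compact_Icc]]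
    by (metis bounded_iff image_eqI real_norm_def)
  have pF: "\<bar>poly (papprox f n) t\<bar> \<le> F + 1" if t: "t \<in> {-1..1}" for n t
  proof -
    have "inverse (real (Suc n)) \<le> 1" by (simp add: field_simps)
    then show ?thesis using papprox[OF f t, of n] F[OF t] by linarith
  qed
  show "(\<lambda>n. act h (papprox f n * papprox g n) a) \<longlonglongrightarrow> fcal h (\<lambda>t. f t * g t) a"
  proof (rule fcal_tendsto)
    show "(\<lambda>n. (F + 1 + G) * inverse (real (Suc n))) \<longlonglongrightarrow> 0"
      using tendsto_mult_left[OF LIMSEQ_inverse_real_of_nat, of "F + 1 + G"] by simp
    fix t :: real and n assume t: "t \<in> {-1..1}"
    let ?e = "inverse (real (Suc n))" and ?p = "poly (papprox f n) t" and ?q = "poly (papprox g n) t"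
    have "\<bar>?p * ?q - f t * g t\<bar> = \<bar>?p * (?q - g t) + (?p - f t) * g t\<bar>" by (simp add: algebra_simps)
    also have "\<dots> \<le> \<bar>?p\<bar> * \<bar>?q - g t\<bar> + \<bar>?p - f t\<bar> * \<bar>g t\<bar>"
      using abs_triangle_ineq[of "?p * (?q - g t)" "(?p - f t) * g t"] by (simp add: abs_mult)
    also have "\<dots> \<le> (F + 1) * ?e + ?e * G"
      using pF[OF t, of n] papprox[OF f t, of n] papprox[OF g t, of n] G[OF t]
      by (intro add_mono mult_mono) auto
    finally show "\<bar>poly (papprox f n * papprox g n) t - f t * g t\<bar> \<le> (F + 1 + G) * ?e"
      by (simp add: algebra_simps)
  qed (intro continuous_intros f g)
  have "(\<lambda>n. act h (papprox f n) (act h (papprox g n) a) - act h (papprox f n) (fcal h g a)) \<longlonglongrightarrow> 0"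
  proof (rule Lim_null_comparison)
    have "norm (act h (papprox f n) (act h (papprox g n) a) - act h (papprox f n) (fcal h g a)) \<le>
        (F + 1) * norm (act h (papprox g n) a - fcal h g a)" for n
    proof -
      have "act h (papprox f n) (act h (papprox g n) a) - act h (papprox f n) (fcal h g a)
          = act h (papprox f n) (act h (papprox g n) a - fcal h g a)"
        using act_add_right[of h "papprox f n" "act h (papprox g n) a - fcal h g a" "fcal h g a"] by simp
      then show ?thesis using norm_act_le[OF pF] by simp
    qed
    then show "\<forall>\<^sub>F n in sequentially. norm (act h (papprox f n) (act h (papprox g n) a) - act h (papprox f n) (fcal h g a))
       \<le> (F + 1) * norm (act h (papprox g n) a - fcal h g a)" by simp
    have "(\<lambda>n. (F + 1) * norm (act h (papprox g n) a - fcal h g a)) \<longlonglongrightarrow> (F + 1) * norm (fcal h g a - fcal h g a)"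
      by (intro tendsto_intros fcal_lim g)
    then show "(\<lambda>n. (F + 1) * norm (act h (papprox g n) a - fcal h g a)) \<longlonglongrightarrow> 0" by simp
  qed
  from tendsto_add[OF this fcal_lim[OF f, of "fcal h g a"]]
  show "(\<lambda>n. act h (papprox f n * papprox g n) a) \<longlonglongrightarrow> fcal h f (fcal h g a)"
    by (simp add: act_mult)
qed

lemma fcal_mult_right:
  assumes f: "continuous_on {-1..1} f"
  shows "fcal h f (a * b) = fcal h f a * b"
proof (rule LIMSEQ_unique[OF fcal_lim[OF f]])
  show "(\<lambda>n. act h (papprox f n) (a * b)) \<longlonglongrightarrow> fcal h f a * b"
    unfolding act_mult_right by (intro tendsto_intros fcal_lim f)
qed

lemma adj_fcal:
  assumes f: "continuous_on {-1..1} f"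
  shows "(fcal h f a)\<^sup>\<star> * b = a\<^sup>\<star> * fcal h f b"
proof (rule LIMSEQ_unique)
  show "(\<lambda>n. (act h (papprox f n) a)\<^sup>\<star> * b) \<longlonglongrightarrow> (fcal h f a)\<^sup>\<star> * b"
    by (intro tendsto_intros tendsto_adj fcal_lim f)
  show "(\<lambda>n. (act h (papprox f n) a)\<^sup>\<star> * b) \<longlonglongrightarrow> a\<^sup>\<star> * fcal h f b"
    unfolding adj_act[OF selfadj] by (intro tendsto_intros fcal_lim f)
qed

lemma fcal_cong:
  assumes "continuous_on {-1..1} f" "\<And>t. t \<in> {-1..1} \<Longrightarrow> f t = g t"
  shows "fcal h f a = fcal h g a"
proof (rule LIMSEQ_unique[OF fcal_lim[OF assms(1)]])
  have g: "continuous_on {-1..1} g" using assms continuous_on_cong by metis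
  show "(\<lambda>n. act h (papprox f n) a) \<longlonglongrightarrow> fcal h g a"
    by (rule fcal_tendsto[OF g _ LIMSEQ_inverse_real_of_nat]) (use papprox[OF assms(1)] assms(2) in simp)
qed

text \<open>Subtracting the value at 0 at most doubles the error, since \<open>f 0 = 0\<close>, and
  makes each approximant divisible by the variable. Its action is then left multiplication by the
  element \<open>act h (q n) h\<close>, and these elements converge.\<close>

lemma el_exists:
  assumes f: "continuous_on {-1..1} f" and f0: "f 0 = 0"
  shows "\<exists>!e. \<forall>a. e * a = fcal h f a"
proof -
  define p where "p n = papprox f n - [:poly (papprox f n) 0:]" for n
  have "\<exists>q. p n = pCons 0 q" for n
  proof -
    have "poly (p n) 0 = 0" by (simp add: p_def)
    then show ?thesis by (cases "p n") auto
  qed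
  then obtain q where q: "\<And>n. p n = pCons 0 (q n)" by metis
  define r where "r n = 2 * inverse (real (Suc n))" for n
  have r: "r \<longlonglongrightarrow> 0" 
    using tendsto_mult_left[OF LIMSEQ_inverse_real_of_nat, of 2] by (simp add: r_def[abs_def])
  have pf: "\<bar>poly (p n) t - f t\<bar> \<le> r n" if t: "t \<in> {-1..1}" for n t
    using papprox[OF f t, of n] papprox[OF f, of 0 n] f0 by (simp add: p_def r_def del: of_nat_Suc)
  have em: "act h (q n) h * a = act h (p n) a" for n a
    by (simp add: q act_commute flip: act_mult_right)
  \<comment> \<open>The bound on the action of \<open>d\<close> is turned into a bound on
    \<open>norm d\<close> by letting \<open>d\<close> act on its own adjoint.\<close>
  have nd: "norm (act h (q m) h - act h (q n) h) \<le> r m + r n" for m n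
  proof -
    define d where "d = act h (q m) h - act h (q n) h"
    have "d * a = act h (p m) a - act h (p n) a" for a
      by (simp add: d_def em left_diff_distrib)
    moreover have "\<bar>poly (p m) t - poly (p n) t\<bar> \<le> r m + r n" if "t \<in> {-1..1}" for t
      using pf[OF that, of m] pf[OF that, of n] by linarith
    ultimately have "norm (d * d\<^sup>\<star>) \<le> (r m + r n) * norm (d\<^sup>\<star>)"
      by (simp only: norm_act_diff_le)
    moreover have "norm (d * d\<^sup>\<star>) = norm d * norm d" using norm_adj_mult_self[of "d\<^sup>\<star>"] by (simp add: adj_adj)
    moreover have "0 \<le> r m + r n" by (simp add: r_def)
    ultimately have "norm d \<le> r m + r n" by (cases "d = 0") auto
    then show ?thesis by (simp add: d_def)
  qed
  have "Cauchy (\<lambda>n. act h (q n) h)"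
  proof (rule metric_CauchyI)
    fix e :: real assume "0 < e"
    then have "\<forall>\<^sub>F n in sequentially. r n < e / 2" using order_tendstoD(2)[OF r, of "e / 2"] by simp
    then obtain N where N: "\<And>n. N \<le> n \<Longrightarrow> r n < e / 2" by (auto simp: eventually_sequentially)
    have "dist (act h (q m) h) (act h (q n) h) < e" if "N \<le> m" "N \<le> n" for m n
      using nd[of m n] N[OF that(1)] N[OF that(2)] by (simp add: dist_norm)
    then show "\<exists>M. \<forall>m\<ge>M. \<forall>n\<ge>M. dist (act h (q m) h) (act h (q n) h) < e" by blast
  qed
  then obtain e where e: "(\<lambda>n. act h (q n) h) \<longlonglongrightarrow> e"
    using Cauchy_convergent_iff convergent_def by blast
  have "e * a = fcal h f a" for a
  proof (rule LIMSEQ_unique)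
    show "(\<lambda>n. act h (p n) a) \<longlonglongrightarrow> e * a" unfolding em[symmetric] by (intro tendsto_intros e)
    show "(\<lambda>n. act h (p n) a) \<longlonglongrightarrow> fcal h f a" by (rule fcal_tendsto[OF f pf r])
  qed
  then show ?thesis by (metis eq_if_mult_eq)
qed

section \<open>Calculus with the elements \<open>el h f\<close>\<close>

lemma el_mult_eq_fcal:
  assumes "continuous_on {-1..1} f" "f 0 = 0"
  shows "el h f * a = fcal h f a"
  using theI'[OF el_exists[OF assms]] by (simp add: el_def)

lemma el_mult:
  assumes "continuous_on {-1..1} f" "f 0 = 0" "continuous_on {-1..1} g" "g 0 = 0"
  shows "el h f * el h g = el h (\<lambda>t. f t * g t)"
proof (rule eq_if_mult_eq)
  fix a
  have "continuous_on {-1..1} (\<lambda>t. f t * g t)" using assms by (intro continuous_intros)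
  then show "el h f * el h g * a = el h (\<lambda>t. f t * g t) * a"
    using assms by (simp add: mult.assoc el_mult_eq_fcal fcal_mult flip: fcal_mult_right)
qed

lemma el_add:
  assumes "continuous_on {-1..1} f" "f 0 = 0" "continuous_on {-1..1} g" "g 0 = 0"
  shows "el h (\<lambda>t. f t + g t) = el h f + el h g"
proof (rule eq_if_mult_eq)
  fix a
  have "continuous_on {-1..1} (\<lambda>t. f t + g t)" using assms by (intro continuous_intros)
  then show "el h (\<lambda>t. f t + g t) * a = (el h f + el h g) * a"
    using assms by (simp add: distrib_right el_mult_eq_fcal fcal_add)
qed

lemma el_cong:
  assumes "continuous_on {-1..1} f" "f 0 = 0" "\<And>t. t \<in> {-1..1} \<Longrightarrow> f t = g t"
  shows "el h f = el h g"
proof (rule eq_if_mult_eq)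
  fix a
  have "continuous_on {-1..1} g" using assms(1,3) continuous_on_cong by metis
  moreover have "g 0 = 0" using assms(2) assms(3)[of 0] by simp
  ultimately show "el h f * a = el h g * a"
    using fcal_cong[OF assms(1,3), of a] assms(1,2) by (simp add: el_mult_eq_fcal)
qed

lemma el_id: "el h (\<lambda>t. t) = h"
  by (rule eq_if_mult_eq) (simp add: el_mult_eq_fcal fcal_id)

lemma adj_el:
  assumes "continuous_on {-1..1} f" "f 0 = 0"
  shows "(el h f)\<^sup>\<star> = el h f"
proof (rule eq_if_mult_eq)
  fix b
  \<comment> \<open>The pairing identity carries an extra factor on the left. Taking adjoints moves
    it to the right, where faithfulness of left multiplication removes it.\<close>
  have "(a\<^sup>\<star> * (el h f)\<^sup>\<star>) * b = a\<^sup>\<star> * (el h f * b)" for a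
    using adj_fcal[OF assms(1), of a b] el_mult_eq_fcal[OF assms] by (simp flip: adj_mult)
  then have "a * ((el h f)\<^sup>\<star> * b) = a * (el h f * b)" for a
    by (metis adj_adj mult.assoc)
  then have "((el h f)\<^sup>\<star> * b)\<^sup>\<star> * a = (el h f * b)\<^sup>\<star> * a" for a
    by (metis adj_adj adj_mult)
  then show "(el h f)\<^sup>\<star> * b = el h f * b" using eq_if_mult_eq adj_adj by metis
qed

lemma norm_el_le:
  assumes "continuous_on {-1..1} f" "f 0 = 0" and B: "\<And>t. t \<in> {-1..1} \<Longrightarrow> \<bar>f t\<bar> \<le> B"
  shows "norm (el h f) \<le> B"
proof -
  have "norm (el h f) * norm (el h f) = norm (el h f * el h f)"
    by (simp add: norm_square_selfadj adj_el assms)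
  also have "\<dots> \<le> B * norm (el h f)" using norm_fcal_le[OF assms(1) B] by (simp add: el_mult_eq_fcal assms)
  finally show ?thesis using order.trans[OF abs_ge_zero B[of 0]] by (cases "el h f = 0") auto
qed

end

section \<open>Positive elements\<close>

text \<open>On the spectrum of \<open>s\<close> the function K - t^2 lies between 0 and K. This norm
  estimate serves in place of an operator inequality until positivity has been established.\<close>

lemma norm_minus_square_mult_le:
  fixes s c :: "'a::cstar_algebra"
  assumes s: "s\<^sup>\<star> = s" and K: "norm s * norm s < K"
  shows "norm (K *\<^sub>R c - s * (s * c)) \<le> K * norm c"
proof -
  have "0 < K" using K by (rule le_less_trans[rotated]) simp
  define h where "h = inverse (sqrt K) *\<^sub>R s"
  have h: "h\<^sup>\<star> = h" by (simp add: h_def adj_scaleR s)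
  have "norm s < sqrt K" using K by (simp add: real_less_rsqrt power2_eq_square)
  then have h1: "norm h < 1" using \<open>0 < K\<close> by (simp add: h_def field_simps)
  have "norm (act h [:1, 0, -1:] c) \<le> 1 * norm c"
  proof (rule norm_act_le[OF h h1])
    fix t :: real assume "t \<in> {-1..1}"
    then have "\<bar>t * t\<bar> \<le> 1" by (simp add: abs_square_le_1 abs_le_iff flip: power2_eq_square)
    then show "\<bar>poly [:1, 0, -1:] t\<bar> \<le> 1" by (simp add: abs_le_iff)
  qed
  moreover have "s * (s * c) = K *\<^sub>R (h * (h * c))"
    using \<open>0 < K\<close> by (simp add: h_def flip: inverse_mult_distrib)
  then have "K *\<^sub>R c - s * (s * c) = K *\<^sub>R act h [:1, 0, -1:] c"
    by (simp add: scaleR_diff_right)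
  ultimately show ?thesis using \<open>0 < K\<close> by simp
qed

text \<open>With B = b^2, the function x (K + x) increases for x \<ge> 0, so its largest value
  should be taken at \<open>norm B\<close>. Without speaking of spectra: B B arises from K B + B B
  by applying x / (K + x), whose sup bound is explicit.\<close>

lemma norm_add_square_ge:
  fixes b :: "'a::cstar_algebra"
  assumes b: "b\<^sup>\<star> = b" and K: "0 < K"
  shows "norm (b * b) * (K + norm (b * b)) \<le> norm (K *\<^sub>R (b * b) + b * b * (b * b))"
proof (cases "b = 0")
  case False
  define B where "B = b * b"
  have B: "B\<^sup>\<star> = B" by (simp add: B_def adj_mult b)
  define N where "N = norm (K *\<^sub>R B + B * B)"
  have nB: "norm B = norm b * norm b" by (simp add: B_def norm_square_selfadj b)
  \<comment> \<open>The calculus requires norm below 1, so \<open>b\<close> is divided by some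
    \<open>r\<close> strictly above its norm; the limit of \<open>r\<close> to \<open>norm b\<close>
    is taken at the end.\<close>
  have le: "norm B * norm B * (K + r * r) \<le> r * r * N" if r: "norm b < r" for r
  proof -
    have r0: "0 < r" using r by (rule le_less_trans[OF norm_ge_zero])
    define h where "h = inverse r *\<^sub>R b"
    have h: "h\<^sup>\<star> = h" by (simp add: h_def adj_scaleR b)
    have h1: "norm h < 1" using r r0 by (simp add: h_def field_simps)
    have bh: "b = r *\<^sub>R h" using r0 by (simp add: h_def)
    define p where "p = [:K, 0, r * r:]"
    define q where "q = [:0, 0, r * r:]"
    have p0: "0 < poly p t" for t
      using K mult_nonneg_nonneg[OF zero_le_square[of r] zero_le_square[of t]]
      by (simp add: p_def algebra_simps add_pos_nonneg)
    have pB: "act h p B = K *\<^sub>R B + B * B"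
      by (simp add: p_def B_def bh mult.assoc)
    have qB: "act h q B = B * B" by (simp add: q_def B_def bh mult.assoc)
    have cont: "continuous_on {-1..1} (\<lambda>t. poly q t / poly p t)"
      by (intro continuous_intros) (metis p0 less_irrefl)
    have "fcal h (\<lambda>t. poly q t / poly p t * poly p t) B = fcal h (\<lambda>t. poly q t / poly p t) (act h p B)"
      by (subst fcal_mult[OF h h1 cont]) (simp_all add: fcal_poly[OF h h1] continuous_intros)
    moreover have "(\<lambda>t. poly q t / poly p t * poly p t) = poly q"
      using p0 by (intro ext) (metis nonzero_eq_divide_eq less_irrefl)
    ultimately have "B * B = fcal h (\<lambda>t. poly q t / poly p t) (act h p B)"
      by (simp add: fcal_poly[OF h h1] qB)
    also have "norm \<dots> \<le> r * r / (K + r * r) * N"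
      unfolding N_def pB
    proof (rule norm_fcal_le[OF h h1 cont])
      fix t :: real assume "t \<in> {-1..1}"
      then have "t * t \<le> 1" by (simp add: abs_square_le_1 abs_le_iff flip: power2_eq_square)
      then have t: "r * r * (t * t) \<le> r * r" by (intro mult_left_le) auto
      have "0 \<le> r * r * (t * t)" by simp
      moreover have "poly q t = r * r * (t * t)" "poly p t = K + r * r * (t * t)" 
        by (simp_all add: q_def p_def)
      ultimately have "\<bar>poly q t / poly p t\<bar> = r * r * (t * t) / (K + r * r * (t * t))"
        using K by simp
      also have "\<dots> \<le> r * r / (K + r * r)"
      proof -
        have "A / (K + A) \<le> B / (K + B)" if "0 \<le> A" "A \<le> B" for A B
          using K that by (simp add: field_simps)
        then show ?thesis using t \<open>0 \<le> r * r * (t * t)\<close> by blast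
      qed
      finally show "\<bar>poly q t / poly p t\<bar> \<le> r * r / (K + r * r)" .
    qed
    finally have "norm B * norm B \<le> r * r / (K + r * r) * N"
      by (simp add: norm_square_selfadj B)
    then show ?thesis using K by (simp add: field_simps add_pos_nonneg)
  qed
  have "norm B * norm B * (K + norm b * norm b) \<le> norm b * norm b * N"
  proof (rule LIMSEQ_le)
    let ?r = "\<lambda>n. norm b + inverse (real (Suc n))"
    have r: "?r \<longlonglongrightarrow> norm b" using tendsto_add[OF tendsto_const LIMSEQ_inverse_real_of_nat] by simp
    show "(\<lambda>n. norm B * norm B * (K + ?r n * ?r n)) \<longlonglongrightarrow> norm B * norm B * (K + norm b * norm b)"
      by (intro tendsto_intros r)
    show "(\<lambda>n. ?r n * ?r n * N) \<longlonglongrightarrow> norm b * norm b * N" by (intro tendsto_intros r)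
    show "\<exists>M. \<forall>n\<ge>M. norm B * norm B * (K + ?r n * ?r n) \<le> ?r n * ?r n * N"
      using le[of "?r n" for n] by (metis less_add_same_cancel1 inverse_positive_iff_positive of_nat_0_less_iff zero_less_Suc)
  qed
  then have "norm B * (norm B * (K + norm B)) \<le> norm B * N" by (simp add: nB mult_ac)
  then have "norm B * (K + norm B) \<le> N"
    by (rule mult_left_le_imp_le) (use False nB in simp)
  then show ?thesis by (simp add: N_def B_def)
qed simp

text \<open>The elements \<open>c\<^sup>\<star> c\<close> and \<open>c c\<^sup>\<star>\<close> have the same spectrum up to \<open>0\<close>, and \<open>c c\<^sup>\<star>\<close> would be a sum of
  self-adjoint squares. Compare the norms of \<open>L c\<^sup>\<star> c - 2 c\<^sup>\<star> (c c\<^sup>\<star>) c\<close> computed both ways.\<close>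

lemma square_zero_if_neg:
  fixes b c :: "'a::cstar_algebra"
  assumes b: "b\<^sup>\<star> = b" and cc: "c\<^sup>\<star> * c = - (b * b)"
  shows "b = 0"
proof -
  \<comment> \<open>\<open>c1\<close> and \<open>c2\<close> are twice the real and imaginary parts
    of \<open>c\<close>. Their squares add up to 2 (c c* + c* c), and the hypothesis turns this into
    2 c c* = c1^2 + c2^2 + 2 b^2.\<close>
  define c1 where "c1 = c + c\<^sup>\<star>"
  define c2 where "c2 = \<i> *\<^sub>C (c\<^sup>\<star> - c)"
  have i2: "\<i> *\<^sub>C \<i> *\<^sub>C x = - x" for x :: 'a
    using scaleC_scaleC[of \<i> \<i> x] scaleC_minus_left[of 1 x] by (simp add: scaleC_one)
  have c1: "c1\<^sup>\<star> = c1" by (simp add: c1_def adj_add adj_adj add.commute)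
  have c2: "c2\<^sup>\<star> = c2"
    by (simp add: c2_def adj_scaleC adj_diff adj_adj scaleC_minus_left scaleC_diff_right)
  have "c1 * c1 + c2 * c2 = 2 *\<^sub>R (c * c\<^sup>\<star>) + 2 *\<^sub>R (c\<^sup>\<star> * c)"
    by (simp add: c1_def c2_def mult_scaleC_left mult_scaleC_right i2 scaleR_2 algebra_simps scaleC_diff_right)
  then have "2 *\<^sub>R (c * c\<^sup>\<star>) = c1 * c1 + c2 * c2 + 2 *\<^sub>R (b * b)" by (simp add: cc)
  then have sq: "2 *\<^sub>R (c * (c\<^sup>\<star> * c)) = c1 * (c1 * c) + c2 * (c2 * c) + 2 *\<^sub>R (b * (b * c))"
    by (metis distrib_right mult.assoc mult_scaleR_left)
  define K where "K s = norm s * norm s + 1" for s :: 'a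
  \<comment> \<open>\<open>K s\<close> exceeds the square of \<open>norm s\<close>, so
    \<open>L\<close> dominates the sum of squares that represents 2 c c*.\<close>
  define L where "L = K c1 + K c2 + 2 * K b"
  have L: "0 < L" by (simp add: L_def K_def add_pos_nonneg)
  have le: "norm (K s *\<^sub>R c - s * (s * c)) \<le> K s * norm c" if "s\<^sup>\<star> = s" for s
    using that by (rule norm_minus_square_mult_le) (simp add: K_def)
  have "L *\<^sub>R c - 2 *\<^sub>R (c * (c\<^sup>\<star> * c)) = (K c1 *\<^sub>R c - c1 * (c1 * c)) + (K c2 *\<^sub>R c - c2 * (c2 * c))
      + 2 *\<^sub>R (K b *\<^sub>R c - b * (b * c))"
    unfolding sq L_def by (simp add: scaleR_add_left scaleR_diff_right)
  also have "norm \<dots> \<le> K c1 * norm c + K c2 * norm c + 2 * (K b * norm c)"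
    by (intro order.trans[OF norm_triangle_ineq] add_mono le c1 c2) (simp add: le b)
  finally have n: "norm (L *\<^sub>R c - 2 *\<^sub>R (c * (c\<^sup>\<star> * c))) \<le> L * norm c"
    by (simp add: L_def algebra_simps)
  \<comment> \<open>The sign decides: because c* c is negative, both terms reinforce each other and
    the norm is at least L norm (b b) + 2 norm (b b)^2. The estimate from the sum of squares allows
    only L norm (b b).\<close>
  have "c\<^sup>\<star> * (L *\<^sub>R c - 2 *\<^sub>R (c * (c\<^sup>\<star> * c))) = L *\<^sub>R (c\<^sup>\<star> * c) - 2 *\<^sub>R ((c\<^sup>\<star> * c) * (c\<^sup>\<star> * c))"
    by (simp add: right_diff_distrib mult.assoc)
  also have "\<dots> = - (2 *\<^sub>R ((L/2) *\<^sub>R (b * b) + b * b * (b * b)))"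
    by (simp add: cc scaleR_add_right)
  finally have "2 * norm ((L/2) *\<^sub>R (b * b) + b * b * (b * b)) = norm (c\<^sup>\<star> * (L *\<^sub>R c - 2 *\<^sub>R (c * (c\<^sup>\<star> * c))))"
    by simp
  also have "\<dots> \<le> norm c * (L * norm c)"
    by (rule order.trans[OF norm_mult_ineq]) (simp add: mult_left_mono n)
  also have "\<dots> = L * norm (b * b)" using norm_adj_mult_self[of c] by (simp add: cc)
  finally have "2 * (norm (b * b) * (L/2 + norm (b * b))) \<le> L * norm (b * b)"
    using norm_add_square_ge[OF b, of "L/2"] L by simp
  then have "norm (b * b) * norm (b * b) \<le> 0" by (simp add: algebra_simps)
  then have "norm (b * b) = 0" using mult_eq_0_iff zero_le_square antisym by metis
  then show ?thesis by (simp add: norm_square_selfadj b)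
qed

text \<open>Kaplansky's argument. With \<open>g\<close> the negative part, \<open>s\<close> its root
  and x = w* w, the element c = w s(x) satisfies c* c = - g(x)^2, so g(x) = 0. Hence x equals its
  positive part, the square of \<open>el x r\<close>.\<close>

lemma positive_cone_square_contr:
  fixes w :: "'a::cstar_algebra"
  assumes n: "norm (w\<^sup>\<star> * w) < 1"
  shows "\<exists>b. b\<^sup>\<star> = b \<and> w\<^sup>\<star> * w = b * b"
proof -
  define x where "x = w\<^sup>\<star> * w"
  have x: "x\<^sup>\<star> = x" by (simp add: x_def adj_mult adj_adj)
  have x1: "norm x < 1" using n by (simp add: x_def)
  define g where "g t = max (- t) 0" for t :: real
  define s where "s t = sqrt (g t)" for t
  define r where "r t = sqrt (max t 0)" for t :: real
  have cont: "continuous_on {-1..1} g" "continuous_on {-1..1} s" "continuous_on {-1..1} r"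
    "continuous_on {-1..1} (\<lambda>t::real. t)"
    unfolding g_def s_def r_def by (intro continuous_intros)+
  have z: "g 0 = 0" "s 0 = 0" "r 0 = 0" by (simp_all add: g_def s_def r_def)
  note elm = el_mult[OF x x1] and ela = el_add[OF x x1] and adj_el = adj_el[OF x x1]
  define c where "c = w * el x s"
  have "c\<^sup>\<star> = el x s * w\<^sup>\<star>" by (simp add: c_def adj_mult adj_el cont z)
  then have "c\<^sup>\<star> * c = el x s * (x * el x s)" unfolding c_def x_def by (simp only: mult.assoc)
  also have "\<dots> = el x s * (el x (\<lambda>t. t) * el x s)" by (simp add: el_id[OF x x1])
  also have "\<dots> = el x (\<lambda>t. s t * (t * s t))"
    by (simp add: elm cont z continuous_intros)
  finally have cc: "c\<^sup>\<star> * c = el x (\<lambda>t. s t * (t * s t))" .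
  have "c\<^sup>\<star> * c + el x g * el x g = el x (\<lambda>t. s t * (t * s t) + g t * g t)"
    by (simp add: cc elm ela cont z continuous_intros)
  also have "\<dots> = 0"
  proof -
    have "s t * (t * s t) + g t * g t = 0" for t
    proof -
      have "s t * s t = g t" by (simp add: s_def g_def)
      then have "s t * (t * s t) = t * g t" by (metis mult.left_commute)
      moreover have "t * g t + g t * g t = 0" by (simp add: g_def max_def)
      ultimately show ?thesis by (simp only:)
    qed
    then show ?thesis using norm_el_le[OF x x1, of "\<lambda>_. 0" 0] by simp
  qed
  finally have "c\<^sup>\<star> * c = - (el x g * el x g)" by (simp add: eq_neg_iff_add_eq_0)
  then have g0: "el x g = 0" using square_zero_if_neg adj_el cont z by metis
  have "x = el x (\<lambda>t. t) + el x g" by (simp add: g0 el_id[OF x x1])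
  also have "\<dots> = el x (\<lambda>t. t + g t)" by (simp add: ela cont z)
  also have "(\<lambda>t. t + g t) = (\<lambda>t. r t * r t)" by (auto simp: g_def r_def max_def)
  also have "el x \<dots> = el x r * el x r" by (simp add: elm cont z)
  finally have "x = el x r * el x r" .
  then show ?thesis using adj_el cont z unfolding x_def by metis
qed

lemma positive_cone_square:
  fixes x :: "'a::cstar_algebra"
  assumes "x \<in> positive_cone"
  obtains b where "b\<^sup>\<star> = b" "x = b * b"
proof -
  obtain w where w: "x = w\<^sup>\<star> * w" using assms by (auto simp: positive_cone_def)
  define l where "l = sqrt (inverse (norm x + 1))"
  have l: "0 < l" "l * l = inverse (norm x + 1)" by (simp_all add: l_def add_nonneg_pos add_nonneg_nonneg)
  have lw: "(l *\<^sub>R w)\<^sup>\<star> * (l *\<^sub>R w) = inverse (norm x + 1) *\<^sub>R x"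
    by (simp add: adj_scaleR w l)
  have "norm ((l *\<^sub>R w)\<^sup>\<star> * (l *\<^sub>R w)) < 1"
    unfolding lw by (simp add: add_nonneg_pos pos_divide_less_eq inverse_eq_divide)
  then obtain b where b: "b\<^sup>\<star> = b" "(l *\<^sub>R w)\<^sup>\<star> * (l *\<^sub>R w) = b * b"
    using positive_cone_square_contr by blast
  have "x = (inverse l * inverse l) *\<^sub>R ((l *\<^sub>R w)\<^sup>\<star> * (l *\<^sub>R w))"
  proof -
    have "norm x + 1 \<noteq> 0" using norm_ge_zero[of x] by linarith
    moreover have "inverse l * inverse l = norm x + 1" by (metis l(2) inverse_inverse_eq inverse_mult_distrib)
    ultimately show ?thesis by (simp only: lw scaleR_scaleR) simp
  qed
  also have "\<dots> = (inverse l * inverse l) *\<^sub>R (b * b)" by (simp only: b(2))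
  also have "\<dots> = (inverse l *\<^sub>R b) * (inverse l *\<^sub>R b)" by simp
  finally show ?thesis using that[of "inverse l *\<^sub>R b"] b by (simp add: adj_scaleR)
qed

text \<open>Writing u* u = x, v* v = s^2 and P = x + s^2, one has K x + x^2 = (K - s^2) x + P x. The
  left side has norm at least K norm x + (norm x)^2, the right side at most K norm x + norm P norm
  x.\<close>

lemma norm_le_norm_add_positive:
  fixes u v :: "'a::cstar_algebra"
  shows "norm u * norm u \<le> norm (u\<^sup>\<star> * u + v\<^sup>\<star> * v)"
proof -
  have "u\<^sup>\<star> * u \<in> positive_cone" "v\<^sup>\<star> * v \<in> positive_cone" by (auto simp: positive_cone_def)
  then obtain b s where b: "b\<^sup>\<star> = b" "u\<^sup>\<star> * u = b * b" and s: "s\<^sup>\<star> = s" "v\<^sup>\<star> * v = s * s"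
    by (metis positive_cone_square)
  define x where "x = b * b"
  define P where "P = b * b + s * s"
  define K where "K = norm s * norm s + 1"
  have K: "0 < K" by (simp add: K_def add_nonneg_pos)
  have "norm x * (K + norm x) \<le> norm (K *\<^sub>R x + x * x)"
    unfolding x_def by (rule norm_add_square_ge[OF b(1) K])
  also have "K *\<^sub>R x + x * x = (K *\<^sub>R x - s * (s * x)) + P * x"
    by (simp add: P_def x_def distrib_right mult.assoc)
  also have "norm \<dots> \<le> K * norm x + norm P * norm x"
    by (intro order.trans[OF norm_triangle_ineq] add_mono norm_mult_ineq norm_minus_square_mult_le s)
      (simp add: K_def)
  finally have "norm x * norm x \<le> norm P * norm x" by (simp add: algebra_simps)
  then have "norm x \<le> norm P" by (cases "x = 0") auto
  then show ?thesis using norm_adj_mult_self[of u] by (simp add: b s x_def P_def)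
qed

section \<open>Copies inside a properly infinite element\<close>

lemma norm_component_le_vec_norm: "norm (v $ i) \<le> vec_norm v" for v :: "'a::cstar_algebra^2"
proof -
  have "norm (v $ i) * norm (v $ i) \<le> norm ((v $ 1)\<^sup>\<star> * v $ 1 + (v $ 2)\<^sup>\<star> * v $ 2)"
    using norm_le_norm_add_positive[of "v $ 1" "v $ 2"] norm_le_norm_add_positive[of "v $ 2" "v $ 1"]
      exhaust_2[of i] by (auto simp: add.commute)
  then show ?thesis by (simp add: vec_norm_def sum_2 real_le_rsqrt power2_eq_square)
qed

text \<open>Vectors supported in one coordinate detect single entries. Boundedness is checked
  because a supremum over an unbounded set would give no upper bound.\<close>

lemma norm_entry_le_mat_norm:
  fixes X :: "'a::cstar_algebra^2^2"
  shows "norm (X $ i $ j) \<le> mat_norm X"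
proof -
  define R where "R i = norm (X $ i $ 1) + norm (X $ i $ 2)" for i
  have R0: "0 \<le> R i" for i by (simp add: R_def)
  have bdd: "bdd_above ((\<lambda>v. vec_norm (mat_vec X v)) ` {v. vec_norm v \<le> 1})"
  proof (rule bdd_aboveI2)
    fix v :: "'a^2" assume "v \<in> {v. vec_norm v \<le> 1}"
    then have v: "norm (v $ i) \<le> 1" for i using norm_component_le_vec_norm[of v i] by simp
    have e: "norm (X $ i $ j * v $ j) \<le> norm (X $ i $ j)" for i j
      using norm_mult_ineq[of "X $ i $ j" "v $ j"] mult_left_mono[OF v[of j], of "norm (X $ i $ j)"] by simp
    have c: "norm (mat_vec X v $ i) \<le> R i" for i
      using norm_triangle_ineq[of "X $ i $ 1 * v $ 1" "X $ i $ 2 * v $ 2"] e[of i 1] e[of i 2]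
      by (simp add: mat_vec_def sum_2 R_def)
    have cc: "norm ((mat_vec X v $ i)\<^sup>\<star> * mat_vec X v $ i) \<le> R i * R i" for i
      unfolding norm_adj_mult_self by (intro mult_mono c R0 norm_ge_zero)
    show "vec_norm (mat_vec X v) \<le> sqrt (R 1 * R 1 + R 2 * R 2)"
      unfolding vec_norm_def sum_2
      by (intro real_sqrt_le_mono order.trans[OF norm_triangle_ineq] add_mono cc)
  qed
  have le: "vec_norm (mat_vec X v) \<le> mat_norm X" if "vec_norm v \<le> 1" for v
    unfolding mat_norm_def by (rule cSUP_upper[OF _ bdd]) (use that in simp)
  show ?thesis
  proof (cases "X $ i $ j = 0")
    case True
    have "vec_norm (0 :: 'a^2) \<le> 1" by (simp add: vec_norm_def sum_2)
    then have "norm (mat_vec X 0 $ i) \<le> mat_norm X"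
      using le norm_component_le_vec_norm order.trans by metis
    then show ?thesis using True order.trans[OF norm_ge_zero] by simp
  next
    case False
    \<comment> \<open>In place of a unit vector, the normalised adjoint of the entry: the
      C*-identity shows that the entry attains its norm on it.\<close>
    define a where "a = inverse (norm (X $ i $ j)) *\<^sub>R (X $ i $ j)\<^sup>\<star>"
    define v :: "'a^2" where "v = (\<chi> k. if k = j then a else 0)"
    have a1: "norm a = 1" using False by (simp add: a_def)
    have "(\<Sum>k\<in>UNIV. (v $ k)\<^sup>\<star> * v $ k) = a\<^sup>\<star> * a"
      using exhaust_2[of j] by (auto simp: v_def sum_2)
    then have v: "vec_norm v = 1" by (simp add: vec_norm_def norm_adj_mult_self a1)
    have "mat_vec X v $ i = X $ i $ j * a"
      using exhaust_2[of j] by (auto simp: mat_vec_def v_def sum_2)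
    moreover have "norm (X $ i $ j * a) = norm (X $ i $ j)"
      using norm_adj_mult_self[of "(X $ i $ j)\<^sup>\<star>"] False by (simp add: a_def adj_adj)
    ultimately show ?thesis
      using le[of v] norm_component_le_vec_norm[of "mat_vec X v" i] v by simp
  qed
qed

lemma properly_infinite_approx:
  fixes x :: "'a::cstar_algebra"
  assumes "properly_infinite x" "0 < \<eta>"
  obtains a b where "norm (a\<^sup>\<star> * x * a - x) \<le> \<eta>" "norm (b\<^sup>\<star> * x * b - x) \<le> \<eta>"
    "norm (a\<^sup>\<star> * x * b) \<le> \<eta>" "norm (b\<^sup>\<star> * x * a) \<le> \<eta>"
proof -
  obtain z :: "nat \<Rightarrow> 'a^2^1"
    where "(\<lambda>k. mat_norm (mat_adj (z k) \<bullet>\<^sub>M mat1 x \<bullet>\<^sub>M z k - (x \<oplus> x))) \<longlonglongrightarrow> 0"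
    using assms(1) by (auto simp: properly_infinite_def cuntz_below_def)
  from order_tendstoD(2)[OF this assms(2)] obtain k
    where k: "mat_norm (mat_adj (z k) \<bullet>\<^sub>M mat1 x \<bullet>\<^sub>M z k - (x \<oplus> x)) < \<eta>"
    by (auto simp: eventually_sequentially)
  have e: "norm ((z k $ 1 $ i)\<^sup>\<star> * x * z k $ 1 $ j - (x \<oplus> x) $ i $ j) \<le> \<eta>" for i j
    using order.trans[OF norm_entry_le_mat_norm less_imp_le[OF k], of i j]
    by (simp add: mat_mult_def mat_adj_def mat1_def)
  show ?thesis
    using that[of "z k $ 1 $ 1" "z k $ 1 $ 2"] e[of 1 1] e[of 2 2] e[of 1 2] e[of 2 1]
    by (simp add: oplus_def)
qed

text \<open>Doubling: if \<open>r\<close> gives copies and \<open>a\<close>, \<open>b\<close> give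
  two, then the products \<open>r i * a\<close> and \<open>r i * b\<close> give twice as
  many.\<close>

lemma properly_infinite_copies:
  fixes x :: "'a::cstar_algebra"
  assumes x: "properly_infinite x" and "0 < \<eta>"
  shows "\<exists>r :: nat \<Rightarrow> 'a. \<forall>i < 2 ^ m. \<forall>j < 2 ^ m. norm ((r i)\<^sup>\<star> * x * r j - (if i = j then x else 0)) \<le> \<eta>"
  using \<open>0 < \<eta>\<close>
proof (induction m arbitrary: \<eta>)
  case 0
  then obtain a b where "norm (a\<^sup>\<star> * x * a - x) \<le> \<eta>" using properly_infinite_approx[OF x] by metis
  then show ?case by (intro exI[of _ "\<lambda>_. a"]) simp
next
  case (Suc m)
  obtain a b where ab: "norm (a\<^sup>\<star> * x * a - x) \<le> \<eta> / 2" "norm (b\<^sup>\<star> * x * b - x) \<le> \<eta> / 2"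
    "norm (a\<^sup>\<star> * x * b) \<le> \<eta> / 2" "norm (b\<^sup>\<star> * x * a) \<le> \<eta> / 2"
    using properly_infinite_approx[OF x half_gt_zero[OF Suc.prems]] by metis
  define M where "M = norm a + norm b + 1"
  have M: "0 < M" "norm a \<le> M" "norm b \<le> M" by (auto simp: M_def add_nonneg_pos)
  \<comment> \<open>The error of the old copies is multiplied on both sides by \<open>a\<close> or
    \<open>b\<close>, each of norm at most \<open>M\<close>, and should cost at most half of
    \<eta>.\<close>
  define \<epsilon> where "\<epsilon> = \<eta> / (2 * (M * M))"
  have "0 < \<epsilon>" using M Suc.prems by (simp add: \<epsilon>_def)
  then obtain r :: "nat \<Rightarrow> 'a" where r: "\<And>i j. i < 2 ^ m \<Longrightarrow> j < 2 ^ m \<Longrightarrow>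
      norm ((r i)\<^sup>\<star> * x * r j - (if i = j then x else 0)) \<le> \<epsilon>"
    using Suc.IH by blast
  define e where "e i = (if i < 2 ^ m then a else b)" for i :: nat
  define k where "k i = (if i < 2 ^ m then i else i - 2 ^ m)" for i :: nat
  have "norm ((r (k i) * e i)\<^sup>\<star> * x * (r (k j) * e j) - (if i = j then x else 0)) \<le> \<eta>"
    if ij: "i < 2 ^ Suc m" "j < 2 ^ Suc m" for i j
  proof -
    have k: "k i < 2 ^ m" "k j < 2 ^ m" using ij by (auto simp: k_def)
    \<comment> \<open>\<open>D\<close> is the error inherited from the old copies. \<open>E\<close>
      is the error of the pair \<open>a\<close>, \<open>b\<close>, which enters only when both
      indices refer to the same old copy.\<close>
    define D where "D = (r (k i))\<^sup>\<star> * x * r (k j) - (if k i = k j then x else 0)"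
    define E where "E = (if k i = k j then (e i)\<^sup>\<star> * x * e j - (if i = j then x else 0) else 0)"
    have "(r (k i) * e i)\<^sup>\<star> * x * (r (k j) * e j) - (if i = j then x else 0) = (e i)\<^sup>\<star> * D * e j + E"
      by (auto simp: D_def E_def adj_mult algebra_simps)
    moreover have "norm ((e i)\<^sup>\<star> * D * e j) \<le> \<eta> / 2"
    proof -
      have "norm ((e i)\<^sup>\<star> * D * e j) \<le> norm ((e i)\<^sup>\<star>) * norm D * norm (e j)"
        by (intro order.trans[OF norm_mult_ineq] mult_right_mono norm_mult_ineq) simp
      also have "\<dots> \<le> M * \<epsilon> * M"
        using M \<open>0 < \<epsilon>\<close> r[OF k] by (intro mult_mono) (auto simp: e_def D_def)
      also have "\<dots> = \<eta> / 2" using M by (simp add: \<epsilon>_def)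
      finally show ?thesis .
    qed
    moreover have "norm E \<le> \<eta> / 2"
      using ij ab Suc.prems by (auto simp: E_def e_def k_def)
    ultimately show ?thesis using norm_triangle_ineq[of "(e i)\<^sup>\<star> * D * e j" E] by simp
  qed
  then show ?case by (intro exI[of _ "\<lambda>i. r (k i) * e i"]) blast
qed

text \<open>The condition on \<open>e'\<close> permits the later division by \<open>b\<close>. The
  last bound does not involve the number of summands, so that the series over all slices converges
  absolutely.\<close>

lemma exact_small_decomposition:
  fixes d e e' :: "'a::cstar_algebra"
  assumes pinf: "properly_infinite (e * e)"
    and d: "d\<^sup>\<star> = d" and e: "e\<^sup>\<star> = e" and ed: "e * d = d" and ee: "e' * e = e"
    and ne: "norm e \<le> 1" and "0 < \<epsilon>"
  shows "\<exists>(N::nat) z. (\<Sum>i<N. (z i)\<^sup>\<star> * z i) = d * d \<and> (\<forall>i. e' * z i = z i) \<and>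
    norm (\<Sum>i<N. z i * (z i)\<^sup>\<star>) \<le> \<epsilon> \<and> (\<Sum>i<N. norm (z i) * norm (z i)) \<le> 4 * (norm d * norm d)"
proof -
  define \<beta> where "\<beta> = norm d * norm d"
  have \<beta>: "0 \<le> \<beta>" by (simp add: \<beta>_def)
  \<comment> \<open>\<eta> is the slack. The remainder \<open>g\<close> has squared norm at most 4
    \<eta> \<beta>, which is to be at most \<epsilon> / 2; adding 1 to \<beta> avoids a division by
    zero.\<close>
  define \<eta> where "\<eta> = min (1/2) (\<epsilon> / (8 * (\<beta> + 1)))"
  have \<eta>: "0 < \<eta>" using \<beta> \<open>0 < \<epsilon>\<close> by (simp add: \<eta>_def)
  have \<eta>2: "\<eta> \<le> 1/2" unfolding \<eta>_def by (rule min.cobounded1)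
  note \<eta> = \<eta> \<eta>2
  have \<eta>\<beta>: "4 * \<eta> * \<beta> \<le> \<epsilon> / 2"
  proof -
    have "\<eta> * \<beta> \<le> \<epsilon> / (8 * (\<beta> + 1)) * (\<beta> + 1)" using \<beta> \<eta> by (intro mult_mono) (auto simp: \<eta>_def)
    also have "\<dots> = \<epsilon> / 8"
    proof -
      have "\<epsilon> / (8 * B) * B = \<epsilon> / 8" if "0 < B" for B using that by simp
      then show ?thesis using \<beta> by (simp only: add_nonneg_pos zero_less_one)
    qed
    finally show ?thesis by simp
  qed
  \<comment> \<open>The bound for \<open>norm Y * norm Y\<close> will be 4 \<beta>^2 / n, to be
    compared with (\<epsilon> / 2)^2.\<close>
  obtain m where m: "16 * (\<beta> * \<beta>) / (\<epsilon> * \<epsilon>) < 2 ^ m" using real_arch_pow[of 2] by auto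
  define n :: nat where "n = 2 ^ m"
  have n: "0 < real n" by (simp add: n_def)
  have n\<epsilon>: "4 * (\<beta> * \<beta>) / n \<le> (\<epsilon> / 2) * (\<epsilon> / 2)"
    using m n \<open>0 < \<epsilon>\<close> by (simp add: n_def field_simps)
  \<comment> \<open>The bound 1/n keeps the errors of all n^2 pairs together below the n diagonal
    terms; \<eta> / 2 makes the norm of \<tau> at most 1/2.\<close>
  define \<eta>' where "\<eta>' = min (1 / n) (\<eta> / 2)"
  have \<eta>': "0 < \<eta>'" "n * \<eta>' \<le> 1" "\<eta>' \<le> \<eta> / 2" using n \<eta> by (auto simp: \<eta>'_def min_def field_simps)
  have \<eta>'1: "\<eta>' \<le> 1" using \<eta>' \<eta> by linarith
  obtain r :: "nat \<Rightarrow> 'a" where r: "\<And>i j. i < n \<Longrightarrow> j < n \<Longrightarrow>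
      norm ((r i)\<^sup>\<star> * (e * e) * r j - (if i = j then e * e else 0)) \<le> \<eta>'"
    using properly_infinite_copies[OF pinf \<eta>'(1), of m] unfolding n_def by blast
  define D where "D i j = (r i)\<^sup>\<star> * (e * e) * r j - (if i = j then e * e else 0)" for i j
  \<comment> \<open>Each copy carries the share (1 - \<eta>) / n of \<open>d * d\<close>, which
    leaves \<eta> \<open>d * d\<close> for the remainder.\<close>
  define c where "c = sqrt ((1 - \<eta>) / n)"
  have cc: "c * c = (1 - \<eta>) / n" using \<eta> n by (simp add: c_def)
  have cn: "0 \<le> c * c" "c * c \<le> 1 / n" using \<eta> n unfolding cc by (auto simp: divide_right_mono)
  define y where "y i = c *\<^sub>R (e * r i * d)" for i
  have de: "d * e = d" using arg_cong[OF ed, of adj] by (simp add: adj_mult d e)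
  have yy: "(y i)\<^sup>\<star> * y j = (c * c) *\<^sub>R ((if i = j then d * d else 0) + d * D i j * d)" for i j
  proof -
    have "d * (e * e) * d = d * d" by (metis de ed mult.assoc)
    moreover have "(y i)\<^sup>\<star> * y j = (c * c) *\<^sub>R (d * ((r i)\<^sup>\<star> * (e * e) * r j) * d)"
      by (simp add: y_def adj_scaleR adj_mult d e mult.assoc)
    moreover have "(r i)\<^sup>\<star> * (e * e) * r j = (if i = j then e * e else 0) + D i j" by (simp add: D_def)
    ultimately show ?thesis by (simp add: distrib_left distrib_right)
  qed
  have nyy: "norm ((y i)\<^sup>\<star> * y j) \<le> (1 / n) * ((if i = j then \<beta> else 0) + \<beta> * \<eta>')" if "i < n" "j < n" for i j
  proof -
    have "norm (d * D i j * d) \<le> norm d * norm (D i j) * norm d"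
      by (intro order.trans[OF norm_mult_ineq] mult_right_mono norm_mult_ineq) simp
    also have "\<dots> \<le> norm d * \<eta>' * norm d" using r[OF that] by (intro mult_right_mono mult_left_mono) (auto simp: D_def)
    finally have "norm (d * D i j * d) \<le> \<beta> * \<eta>'" by (simp add: \<beta>_def mult_ac)
    moreover have "norm (if i = j then d * d else 0) = (if i = j then \<beta> else 0)"
      by (simp add: \<beta>_def norm_square_selfadj d)
    ultimately have "norm ((if i = j then d * d else 0) + d * D i j * d) \<le> (if i = j then \<beta> else 0) + \<beta> * \<eta>'"
      using norm_triangle_ineq[of "if i = j then d * d else 0" "d * D i j * d"] by linarith
    then show ?thesis unfolding yy using cn \<beta> n \<eta>'
      by (simp only: norm_scaleR abs_of_nonneg) (intro mult_mono; simp)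
  qed
  have y2: "norm (y i) * norm (y i) \<le> 2 * \<beta> / n" if "i < n" for i
  proof -
    have "norm (y i) * norm (y i) \<le> (1 / n) * (\<beta> + \<beta> * \<eta>')"
      using nyy[OF that that] by (simp add: norm_adj_mult_self)
    also have "\<dots> \<le> (1 / n) * (\<beta> + \<beta> * 1)" using n \<beta> \<eta>'1 by (intro mult_left_mono add_left_mono) auto
    finally show ?thesis by simp
  qed
  have yij: "norm (y i) * norm (y j) \<le> 2 * \<beta> / n" if "i < n" "j < n" for i j
  proof -
    have "0 \<le> (norm (y i) - norm (y j)) * (norm (y i) - norm (y j))" by simp
    then show ?thesis using y2[OF that(1)] y2[OF that(2)] by (simp add: algebra_simps)
  qed
  define Y where "Y = (\<Sum>i<n. y i * (y i)\<^sup>\<star>)"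
  \<comment> \<open>The \<open>y i\<close> are almost orthogonal, so only about \<open>n\<close> of the \<open>n\<^sup>2\<close> terms of \<open>Y * Y\<close> matter,
    each of size about \<open>(\<beta> / n)\<^sup>2\<close>.\<close>
  have "norm Y * norm Y = norm (Y * Y)"
    by (rule norm_square_selfadj[symmetric]) (simp add: Y_def adj_sum adj_mult adj_adj)
  also have "Y * Y = (\<Sum>i<n. \<Sum>j<n. y i * ((y i)\<^sup>\<star> * y j) * (y j)\<^sup>\<star>)"
    by (simp add: Y_def sum_product mult.assoc)
  also have "norm \<dots> \<le> (\<Sum>i<n. \<Sum>j<n. 2 * \<beta> / n * ((1 / n) * ((if i = j then \<beta> else 0) + \<beta> * \<eta>')))"
  proof (intro sum_norm_le)
    fix i j assume ij: "i \<in> {..<n}" "j \<in> {..<n}"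
    have "norm (y i * ((y i)\<^sup>\<star> * y j) * (y j)\<^sup>\<star>) \<le> norm (y i) * norm ((y i)\<^sup>\<star> * y j) * norm (y j)"
      by (intro order.trans[OF norm_mult_ineq] order.trans[OF mult_right_mono[OF norm_mult_ineq]]) simp_all
    also have "\<dots> = (norm (y i) * norm (y j)) * norm ((y i)\<^sup>\<star> * y j)" by simp
    also have "\<dots> \<le> 2 * \<beta> / n * ((1 / n) * ((if i = j then \<beta> else 0) + \<beta> * \<eta>'))"
      using ij \<beta> n by (intro mult_mono yij nyy) auto
    finally show "norm (y i * ((y i)\<^sup>\<star> * y j) * (y j)\<^sup>\<star>) \<le> \<dots>" .
  qed
  also have "\<dots> = 2 * \<beta> / n * ((1 / n) * (n * \<beta> + n * (n * (\<beta> * \<eta>'))))"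
  proof -
    have "(\<Sum>j<n. (if i = j then \<beta> else 0) + \<beta> * \<eta>') = \<beta> + n * (\<beta> * \<eta>')" if "i < n" for i
      using that by (simp add: sum.distrib)
    then have "(\<Sum>i<n. \<Sum>j<n. (if i = j then \<beta> else 0) + \<beta> * \<eta>') = n * \<beta> + n * (n * (\<beta> * \<eta>'))"
      by (simp add: distrib_left)
    then show ?thesis by (simp only: sum_distrib_left[symmetric])
  qed
  also have "\<dots> = 2 * (\<beta> * \<beta>) / n * (1 + n * \<eta>')" using n by (simp add: field_simps)
  also have "\<dots> \<le> 2 * (\<beta> * \<beta>) / n * (1 + 1)" using \<eta>'(2) \<beta> n by (intro mult_left_mono add_left_mono) auto
  also have "\<dots> \<le> (\<epsilon> / 2) * (\<epsilon> / 2)" using n\<epsilon> by simp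
  finally have Y: "norm Y \<le> \<epsilon> / 2"
    using \<open>0 < \<epsilon>\<close> by - (rule power2_le_imp_le, simp_all add: power2_eq_square)
  define t where "t = (1 / n) *\<^sub>R (\<Sum>i<n. D i i)"
  have t: "t\<^sup>\<star> = t" by (simp add: t_def adj_scaleR adj_sum D_def adj_diff adj_mult adj_adj e mult.assoc)
  have nt: "norm t \<le> \<eta>'"
  proof -
    have "norm (\<Sum>i<n. D i i) \<le> (\<Sum>i<n. \<eta>')" using r[unfolded D_def[symmetric]] by (intro sum_norm_le) simp
    then show ?thesis using n by (simp add: t_def field_simps)
  qed
  have sy: "(\<Sum>i<n. (y i)\<^sup>\<star> * y i) = (1 - \<eta>) *\<^sub>R (d * d + d * t * d)"
  proof -
    have "(\<Sum>i<n. (y i)\<^sup>\<star> * y i) = (c * c) *\<^sub>R (real n *\<^sub>R (d * d) + d * (\<Sum>i<n. D i i) * d)"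
      by (simp add: yy sum.distrib scaleR_sum_right[symmetric] sum_distrib_left sum_distrib_right sum_constant_scaleR)
    also have "(\<Sum>i<n. D i i) = real n *\<^sub>R t" using n by (simp add: t_def)
    also have "(c * c) *\<^sub>R (real n *\<^sub>R (d * d) + d * (real n *\<^sub>R t) * d) = (1 - \<eta>) *\<^sub>R (d * d + d * t * d)"
      using n by (simp add: cc scaleR_add_right)
    finally show ?thesis .
  qed
  \<comment> \<open>The remainder \<open>d * d - (\<Sum>i<n. (y i)\<^sup>\<star> * y i)\<close> equals \<open>\<eta> d (1 - \<tau>) d\<close>, a single square.\<close>
  define \<tau> where "\<tau> = ((1 - \<eta>) / \<eta>) *\<^sub>R (e * t * e)"
  have \<tau>: "\<tau>\<^sup>\<star> = \<tau>" by (simp add: \<tau>_def adj_scaleR adj_mult e t mult.assoc)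
  have "norm \<tau> \<le> 1 / 2"
  proof -
    have "norm (e * t * e) \<le> norm e * norm t * norm e"
      by (intro order.trans[OF norm_mult_ineq] mult_right_mono norm_mult_ineq) simp
    also have "\<dots> \<le> 1 * (\<eta> / 2) * 1" using ne nt \<eta>' \<eta> by (intro mult_mono) auto
    finally have "norm (e * t * e) \<le> \<eta> / 2" by simp
    moreover have "norm \<tau> = ((1 - \<eta>) / \<eta>) * norm (e * t * e)" using \<eta> by (simp add: \<tau>_def)
    moreover have "\<dots> \<le> (1 / \<eta>) * (\<eta> / 2)"
      using \<eta> calculation(1) by (intro mult_mono divide_right_mono) auto
    ultimately show ?thesis using \<eta> by simp
  qed
  then have \<tau>1: "norm \<tau> < 1" by linarith
  obtain q where q: "q\<^sup>\<star> = q" "q + q = \<tau> + q * q" "norm q \<le> 1"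
    and "\<And>b. b * \<tau> = \<tau> * b \<Longrightarrow> b * q = q * b" and q': "\<And>u. u * \<tau> = \<tau> \<Longrightarrow> u * q = q"
    by (rule sqrt_one_minus_exists[OF \<tau> \<tau>1], rule that)
  define g where "g = sqrt \<eta> *\<^sub>R (d - q * d)"
  have qq: "q * d + q * d = \<tau> * d + q * (q * d)"
    using arg_cong[OF q(2), of "\<lambda>z. z * d"] by (simp add: distrib_right mult.assoc)
  have "g\<^sup>\<star> * g = \<eta> *\<^sub>R ((d - d * q) * (d - q * d))"
    using \<eta> by (simp add: g_def adj_scaleR adj_diff adj_mult d q(1))
  also have "(d - d * q) * (d - q * d) = d * (d - (q * d + q * d) + q * (q * d))"
    by (simp add: algebra_simps)
  also have "\<dots> = d * d - d * \<tau> * d" unfolding qq by (simp add: algebra_simps)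
  also have "d * \<tau> * d = ((1 - \<eta>) / \<eta>) *\<^sub>R (d * t * d)"
  proof -
    have "d * (e * t * e) * d = (d * e) * t * (e * d)" by (simp only: mult.assoc)
    then show ?thesis by (simp add: \<tau>_def de ed)
  qed
  also have "\<eta> *\<^sub>R (d * d - ((1 - \<eta>) / \<eta>) *\<^sub>R (d * t * d)) = \<eta> *\<^sub>R (d * d) - (1 - \<eta>) *\<^sub>R (d * t * d)"
    using \<eta> by (simp add: scaleR_diff_right)
  finally have gg: "g\<^sup>\<star> * g = \<eta> *\<^sub>R (d * d) - (1 - \<eta>) *\<^sub>R (d * t * d)" .
  have ng: "norm g * norm g \<le> 4 * \<eta> * \<beta>"
  proof -
    have "norm (d - q * d) \<le> norm d + norm q * norm d"
      by (rule order.trans[OF norm_triangle_ineq4]) (simp add: norm_mult_ineq)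
    also have "\<dots> \<le> 2 * norm d" using mult_right_mono[OF q(3), of "norm d"] by simp
    finally have "norm (d - q * d) * norm (d - q * d) \<le> (2 * norm d) * (2 * norm d)"
      by (intro mult_mono) auto
    then have "\<eta> * (norm (d - q * d) * norm (d - q * d)) \<le> \<eta> * (4 * \<beta>)"
      using \<eta> by (intro mult_left_mono) (auto simp: \<beta>_def)
    moreover have "norm g * norm g = \<eta> * (norm (d - q * d) * norm (d - q * d))"
      using \<eta> real_sqrt_mult_self[of \<eta>] by (simp add: g_def) 
    ultimately show ?thesis by simp
  qed
  have e'd: "e' * d = d" by (metis ed ee mult.assoc)
  \<comment> \<open>This is why \<tau> contains \<open>e * t * e\<close> instead of
    \<open>t\<close>: the factors \<open>e\<close> disappear next to \<open>d\<close>, but through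
    them \<open>e'\<close> fixes \<tau>, hence \<open>q\<close>, hence \<open>g\<close>.\<close>
  have "e' * \<tau> = \<tau>" using ee by (simp add: \<tau>_def flip: mult.assoc)
  then have e'g: "e' * g = g" using q'[of e'] e'd by (simp add: g_def right_diff_distrib flip: mult.assoc)
  have e'y: "e' * y i = y i" for i using ee by (simp add: y_def flip: mult.assoc)
  define z where "z i = (if i < n then y i else g)" for i
  have "(\<Sum>i<Suc n. (z i)\<^sup>\<star> * z i) = d * d"
    by (simp add: z_def sy gg algebra_simps)
  moreover have "e' * z i = z i" for i by (simp add: z_def e'g e'y)
  moreover have "norm (\<Sum>i<Suc n. z i * (z i)\<^sup>\<star>) \<le> \<epsilon>"
  proof -
    have "norm (g * g\<^sup>\<star>) \<le> \<epsilon> / 2" using norm_adj_mult_self[of "g\<^sup>\<star>"] ng \<eta>\<beta> by (simp add: adj_adj)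
    then have "norm (Y + g * g\<^sup>\<star>) \<le> \<epsilon>" using norm_triangle_ineq[of Y "g * g\<^sup>\<star>"] Y by linarith
    moreover have "(\<Sum>i<Suc n. z i * (z i)\<^sup>\<star>) = Y + g * g\<^sup>\<star>" by (simp add: z_def Y_def)
    ultimately show ?thesis by (simp only:)
  qed
  moreover have "(\<Sum>i<Suc n. norm (z i) * norm (z i)) \<le> 4 * (norm d * norm d)"
  proof -
    have "(\<Sum>i<n. norm (y i) * norm (y i)) \<le> (\<Sum>i<n. 2 * \<beta> / n)" by (intro sum_mono y2) simp
    also have "\<dots> = 2 * \<beta>" using n by simp
    finally have "(\<Sum>i<Suc n. norm (z i) * norm (z i)) \<le> 2 * \<beta> + 4 * \<eta> * \<beta>" using ng by (simp add: z_def)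
    moreover have "\<eta> * \<beta> \<le> (1/2) * \<beta>" using \<eta> \<beta> by (intro mult_right_mono)
    ultimately show ?thesis unfolding \<beta>_def[symmetric] by linarith
  qed
  ultimately show ?thesis by blast
qed

section \<open>Shrinking a positive element within its equivalence class\<close>

text \<open>Finiteness is tested on a single sequence, so the finite blocks are enumerated by
  \<open>prod_decode\<close>, padded with 0. Absolute convergence makes the sum independent of this
  order.\<close>

lemma sums_flatten:
  fixes w :: "nat \<Rightarrow> nat \<Rightarrow> 'b::banach"
  assumes s: "(\<lambda>k. \<Sum>i<N k. w k i) sums s" and abs: "summable (\<lambda>k. \<Sum>i<N k. norm (w k i))"
  shows "(\<lambda>p. case prod_decode p of (k, i) \<Rightarrow> if i < N k then w k i else 0) sums s"
proof -
  let ?S = "Sigma UNIV (\<lambda>k. {..<N k})"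
  have "(\<lambda>x. norm (case x of (k, i) \<Rightarrow> w k i)) summable_on ?S"
    using abs by (subst Infinite_Sum.abs_summable_on_Sigma_iff)
      (simp add: summable_on_UNIV_nonneg_real_iff sum_nonneg)
  then have S: "(\<lambda>(k, i). w k i) summable_on ?S" by (rule abs_summable_summable)
  have "summable (\<lambda>k. norm (\<Sum>i<N k. w k i))"
    by (rule summable_comparison_test'[OF abs, of 0]) (simp add: norm_sum)
  from norm_summable_imp_has_sum[OF this s]
  have "((\<lambda>k. \<Sum>i<N k. w k i) has_sum s) UNIV" .
  then have "(\<Sum>\<^sub>\<infinity>k. \<Sum>\<^sub>\<infinity>i\<in>{..<N k}. w k i) = s" by (simp add: infsumI)
  then have "infsum (\<lambda>(k, i). w k i) ?S = s" using infsum_Sigma'_banach[OF S] by simp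
  then have "((\<lambda>(k, i). w k i) has_sum s) ?S" using has_sum_infsum[OF S] by simp
  then have "((\<lambda>(k, i). if i < N k then w k i else 0) has_sum s) UNIV"
    by (rule has_sum_cong_neutral[THEN iffD1, rotated -1]) (auto split: if_splits)
  then have "((\<lambda>p. case prod_decode p of (k, i) \<Rightarrow> if i < N k then w k i else 0) has_sum s) UNIV"
    using has_sum_reindex_bij_betw[OF bij_prod_decode] by blast
  then show ?thesis by (rule has_sum_imp_sums)
qed

lemma purely_infinite_small_equivalent:
  fixes b :: "'a::cstar_algebra"
  assumes pinf: "purely_infinite TYPE('a)" and b: "b\<^sup>\<star> = b" and b1: "norm b < 1"
  obtains z T where "(\<lambda>k. (z k)\<^sup>\<star> * z k) sums (b * b)" "(\<lambda>k. z k * (z k)\<^sup>\<star>) sums (b * T * b)"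
    "T\<^sup>\<star> = T" "norm T \<le> 1 / 2"
proof -
  note elm = el_mult[OF b b1] and ela = el_add[OF b b1] and ead = adj_el[OF b b1] and eid = el_id[OF b b1]
    and ele = norm_el_le[OF b b1] and econg = el_cong[OF b b1]
  define \<delta> where "\<delta> k = (1/2::real) ^ Suc k" for k
  have \<delta>: "0 < \<delta> k" for k by (simp add: \<delta>_def)
  \<comment> \<open>The functions (t^2 - 2^(-k))_+ rise from 0 at k = 0 to t^2 on the interval.
    Their increments vanish where t^2 \<le> \<delta> k and are at most \<delta> k, so they are the
    squares \<phi> k^2 that form the slices.\<close>
  define s where "s k t = max (t * t - (1/2::real) ^ k) 0" for k t
  define \<phi> where "\<phi> k t = sqrt (s (Suc k) t - s k t)" for k t
  \<comment> \<open>A ramp from 0 at t^2 = d / 2 to 1 at t^2 = d. Halving \<open>d\<close> gives a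
    cutoff equal to 1 wherever the previous one is nonzero.\<close>
  define \<kappa> where "\<kappa> d t = min 1 (max 0 (2 * (t * t) / d - 1))" for d t :: real
  \<comment> \<open>This is \<kappa> d t / t, made continuous at 0: the maximum equals t^2 wherever
    \<kappa> is nonzero.\<close>
  define \<psi> where "\<psi> d t = \<kappa> d t * (t / max (t * t) (d / 2))" for d t :: real
  have cs: "continuous_on {-1..1} (s k)" for k unfolding s_def by (intro continuous_intros)
  have c\<phi>: "continuous_on {-1..1} (\<phi> k)" for k unfolding \<phi>_def by (intro continuous_intros cs)
  have c\<kappa>: "continuous_on {-1..1} (\<kappa> d)" if "0 < d" for d
    unfolding \<kappa>_def using that by (intro continuous_intros) auto
  have c\<psi>: "continuous_on {-1..1} (\<psi> d)" if "0 < d" for d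
    unfolding \<psi>_def using that by (intro continuous_intros c\<kappa>) (auto simp: max_def)
  have \<kappa>1: "\<kappa> d t = 1" if "0 < d" "d \<le> t * t" for d t using that by (simp add: \<kappa>_def field_simps)
  have \<kappa>0: "\<kappa> d t = 0" if "0 < d" "t * t \<le> d / 2" for d t using that by (simp add: \<kappa>_def field_simps)
  have \<kappa>a: "\<bar>\<kappa> d t\<bar> \<le> 1" for d t by (simp add: \<kappa>_def)
  have z: "s k 0 = 0" "\<phi> k 0 = 0" "\<psi> d 0 = 0" for k d by (simp_all add: s_def \<phi>_def \<psi>_def)
  have z\<kappa>: "\<kappa> d 0 = 0" if "0 < d" for d using \<kappa>0[OF that, of 0] that by simp
  have ds: "0 \<le> s (Suc k) t - s k t" "s (Suc k) t - s k t \<le> \<delta> k" for k t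
  proof -
    have "0 \<le> max (u - p / 2) 0 - max (u - p) 0 \<and> max (u - p / 2) 0 - max (u - p) 0 \<le> p / 2"
      if "0 \<le> u" "0 \<le> p" for u p :: real using that by (auto simp: max_def)
    from this[of "t * t" "(1/2) ^ k"] show "0 \<le> s (Suc k) t - s k t" "s (Suc k) t - s k t \<le> \<delta> k"
      by (simp_all add: s_def \<delta>_def)
  qed
  have ds0: "s (Suc k) t - s k t = 0" if "t * t \<le> \<delta> k" for k t
  proof -
    have "t * t - (1/2) ^ Suc k \<le> 0" using that by (simp add: \<delta>_def)
    moreover have "(1/2::real) ^ Suc k \<le> (1/2) ^ k" by simp
    ultimately have "t * t - (1/2) ^ k \<le> 0" by linarith
    with \<open>t * t - (1/2) ^ Suc k \<le> 0\<close> show ?thesis by (simp only: s_def max_absorb2 diff_self)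
  qed
  have \<phi>\<phi>: "\<phi> k t * \<phi> k t = s (Suc k) t - s k t" for k t using ds(1) by (simp add: \<phi>_def)
  have \<phi>0: "\<phi> k t = 0" if "t * t \<le> \<delta> k" for k t using ds0[OF that] by (simp add: \<phi>_def)
  have \<kappa>\<phi>: "\<kappa> (\<delta> k) t * \<phi> k t = \<phi> k t" for k t
    using \<kappa>1[OF \<delta>, of k t] \<phi>0[of t k] by (cases "\<delta> k \<le> t * t") auto
  have \<kappa>\<kappa>: "\<kappa> (d / 2) t * \<kappa> d t = \<kappa> d t" if "0 < d" for d t
    using \<kappa>1[of "d / 2" t] \<kappa>0[of d t] that by (cases "d / 2 \<le> t * t") auto
  have t\<psi>: "t * \<psi> d t = \<kappa> d t" if "0 < d" for d t
  proof (cases "t * t \<le> d / 2")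
    case True then show ?thesis using \<kappa>0[OF that True] by (simp add: \<psi>_def)
  next
    case False
    then have "max (t * t) (d / 2) = t * t" "t \<noteq> 0" using that by auto
    then show ?thesis by (simp add: \<psi>_def)
  qed
  define d where "d k = el b (\<phi> k)" for k
  define e where "e k = el b (\<kappa> (\<delta> k))" for k
  define e' where "e' k = el b (\<kappa> (\<delta> k / 2))" for k
  define v where "v k = el b (\<psi> (\<delta> k / 2))" for k
  have \<delta>2: "0 < \<delta> k / 2" for k using \<delta> by simp
  note cont = c\<phi> c\<kappa>[OF \<delta>] c\<kappa>[OF \<delta>2] c\<psi>[OF \<delta>2] z z\<kappa>[OF \<delta>] z\<kappa>[OF \<delta>2]
  have adj: "(d k)\<^sup>\<star> = d k" "(e k)\<^sup>\<star> = e k" "(e' k)\<^sup>\<star> = e' k" "(v k)\<^sup>\<star> = v k" for k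
    unfolding d_def e_def e'_def v_def by (intro ead cont)+
  have ed: "e k * d k = d k" for k
    unfolding d_def e_def by (subst elm) (simp_all add: cont \<kappa>\<phi>)
  have ee: "e' k * e k = e k" for k
    unfolding e'_def e_def by (subst elm) (simp_all add: cont \<kappa>\<kappa>[OF \<delta>])
  have bv: "b * v k = e' k" for k
  proof -
    have "b * v k = el b (\<lambda>t. t) * v k" by (simp add: eid)
    also have "\<dots> = e' k"
      unfolding e'_def v_def by (subst elm) (simp_all add: cont t\<psi>[OF \<delta>2])
    finally show ?thesis .
  qed
  have vb: "v k * b = e' k" for k using arg_cong[OF bv, of adj k] by (simp add: adj_mult adj b)
  have ne: "norm (e k) \<le> 1" for k
    unfolding e_def by (rule ele) (use cont \<kappa>a in auto)
  have dd: "d k * d k = el b (\<lambda>t. s (Suc k) t - s k t)" for k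
    unfolding d_def by (subst elm) (simp_all add: cont \<phi>\<phi>)
  have nd: "norm (d k) * norm (d k) \<le> \<delta> k" for k
  proof -
    have "norm (d k) * norm (d k) = norm (d k * d k)" by (simp add: norm_square_selfadj adj)
    also have "\<dots> \<le> \<delta> k" unfolding dd
      by (rule ele) (use ds z in \<open>auto intro!: continuous_intros cs\<close>)
    finally show ?thesis .
  qed
  have dsum: "(\<Sum>k<K. d k * d k) = el b (s K)" for K
  proof (induction K)
    case 0
    have "norm (el b (s 0)) \<le> 0"
    proof (rule ele[OF cs z(1)])
      fix t :: real assume "t \<in> {-1..1}"
      then have "t * t \<le> 1" by (simp add: abs_square_le_1 abs_le_iff flip: power2_eq_square)
      then show "\<bar>s 0 t\<bar> \<le> 0" by (simp add: s_def)
    qed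
    then show ?case by simp
  next
    case (Suc K)
    have "el b (s K) + el b (\<lambda>t. s (Suc K) t - s K t) = el b (\<lambda>t. s K t + (s (Suc K) t - s K t))"
      by (rule ela[symmetric]) (auto intro!: continuous_intros cs simp: z)
    then show ?case using Suc.IH by (simp add: dd)
  qed
  have dsums: "(\<lambda>k. d k * d k) sums (b * b)"
    unfolding sums_def
  proof (rule Lim_transform)
    show "(\<lambda>K. b * b) \<longlonglongrightarrow> b * b" by simp
    have "norm (b * b - (\<Sum>k<K. d k * d k)) \<le> (1/2) ^ K" for K
    proof -
      have c: "continuous_on {-1..1} (\<lambda>t. t * t - s K t)" by (intro continuous_intros cs)
      have "el b (\<lambda>t. t * t - s K t) + el b (s K) = el b (\<lambda>t. (t * t - s K t) + s K t)"
        by (rule ela[symmetric]) (auto simp: z intro!: c cs)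
      also have "\<dots> = el b (\<lambda>t. t) * el b (\<lambda>t. t)" by (subst elm) auto
      finally have "b * b - (\<Sum>k<K. d k * d k) = el b (\<lambda>t. t * t - s K t)"
        by (simp add: eid dsum eq_diff_eq[symmetric])
      moreover have "norm (el b (\<lambda>t. t * t - s K t)) \<le> (1/2) ^ K"
        by (rule ele[OF c]) (auto simp: z s_def max_def)
      ultimately show ?thesis by simp
    qed
    then show "(\<lambda>K. (\<Sum>k<K. d k * d k) - b * b) \<longlonglongrightarrow> 0"
      unfolding norm_minus_commute[of "b * b"]
      by (intro Lim_null_comparison[OF always_eventually LIMSEQ_power_zero[of "1/2::real"]] allI) simp_all
  qed
  \<comment> \<open>The tolerance pays for multiplying by \<open>v k\<close> on both sides: the norm
    of \<open>t k\<close> becomes at most 2^(-k-2), and these bounds sum to 1/2.\<close>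
  define \<epsilon> where "\<epsilon> k = (1/2) ^ Suc (Suc k) / (1 + norm (v k) * norm (v k))" for k
  have \<epsilon>: "0 < \<epsilon> k" for k by (simp add: \<epsilon>_def add_pos_nonneg)
  have "properly_infinite (e k * e k)" for k
    using pinf by (auto simp: purely_infinite_def positive_cone_def) (metis adj(2))
  then have "\<forall>k. \<exists>(N::nat) z. (\<Sum>i<N. (z i)\<^sup>\<star> * z i) = d k * d k \<and>
    (\<forall>i. e' k * z i = z i) \<and> norm (\<Sum>i<N. z i * (z i)\<^sup>\<star>) \<le> \<epsilon> k \<and>
    (\<Sum>i<N. norm (z i) * norm (z i)) \<le> 4 * (norm (d k) * norm (d k))"
    by (intro allI exact_small_decomposition[OF _ adj(1,2) ed ee ne \<epsilon>])
  from choice[OF this] obtain N :: "nat \<Rightarrow> nat" where "\<forall>k. \<exists>z. (\<Sum>i<N k. (z i)\<^sup>\<star> * z i) = d k * d k \<and>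
    (\<forall>i. e' k * z i = z i) \<and> norm (\<Sum>i<N k. z i * (z i)\<^sup>\<star>) \<le> \<epsilon> k \<and>
    (\<Sum>i<N k. norm (z i) * norm (z i)) \<le> 4 * (norm (d k) * norm (d k))" ..
  from choice[OF this] obtain w :: "nat \<Rightarrow> nat \<Rightarrow> 'a" where "\<forall>k. (\<Sum>i<N k. (w k i)\<^sup>\<star> * w k i) = d k * d k \<and>
    (\<forall>i. e' k * w k i = w k i) \<and> norm (\<Sum>i<N k. w k i * (w k i)\<^sup>\<star>) \<le> \<epsilon> k \<and>
    (\<Sum>i<N k. norm (w k i) * norm (w k i)) \<le> 4 * (norm (d k) * norm (d k))" ..
  then have w: "(\<Sum>i<N k. (w k i)\<^sup>\<star> * w k i) = d k * d k"
    "e' k * w k i = w k i" "norm (\<Sum>i<N k. w k i * (w k i)\<^sup>\<star>) \<le> \<epsilon> k"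
    "(\<Sum>i<N k. norm (w k i) * norm (w k i)) \<le> 4 * (norm (d k) * norm (d k))" for k i
    by blast+
  have abs: "summable (\<lambda>k. \<Sum>i<N k. norm (w k i) * norm (w k i))"
  proof (rule summable_comparison_test')
    show "summable (\<lambda>k. 2 * (1/2::real) ^ k)" by (intro summable_mult summable_geometric) simp
    show "norm (\<Sum>i<N k. norm (w k i) * norm (w k i)) \<le> 2 * (1/2) ^ k" for k
      using w(4)[of k] nd[of k] by (simp add: \<delta>_def sum_nonneg)
  qed
  define Y where "Y k = (\<Sum>i<N k. w k i * (w k i)\<^sup>\<star>)" for k
  define t where "t k = v k * Y k * v k" for k
  \<comment> \<open>\<open>b\<close> times \<open>v k\<close>, in either order, is
    \<open>e' k\<close>, and \<open>e' k\<close> fixes every \<open>w k i\<close>. Thus the sandwich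
    returns \<open>Y k\<close> unchanged.\<close>
  have btb: "b * t k * b = Y k" for k
  proof -
    have we: "(w k i)\<^sup>\<star> * e' k = (w k i)\<^sup>\<star>" for i
      using arg_cong[OF w(2), of adj k i] by (simp add: adj_mult adj)
    have "b * t k * b = (b * v k) * Y k * (v k * b)" by (simp add: t_def mult.assoc)
    also have "\<dots> = (\<Sum>i<N k. (e' k * w k i) * ((w k i)\<^sup>\<star> * e' k))"
      by (simp add: bv vb Y_def sum_distrib_left sum_distrib_right mult.assoc)
    finally show ?thesis by (simp add: w(2) we Y_def)
  qed
  have nt: "norm (t k) \<le> (1/2) ^ Suc (Suc k)" for k
  proof -
    have "norm (t k) \<le> norm (v k) * norm (Y k) * norm (v k)"
      unfolding t_def by (intro order.trans[OF norm_mult_ineq] mult_right_mono norm_mult_ineq) simp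
    also have "\<dots> \<le> norm (v k) * \<epsilon> k * norm (v k)"
      using w(3) by (intro mult_right_mono mult_left_mono) (auto simp: Y_def)
    also have "\<dots> \<le> \<epsilon> k * (1 + norm (v k) * norm (v k))" using \<epsilon>[of k] by (simp add: algebra_simps)
    also have "\<dots> = (1/2) ^ Suc (Suc k)"
    proof -
      have "1 + norm (v k) * norm (v k) \<noteq> 0" by (metis add_pos_nonneg less_irrefl zero_le_square zero_less_one)
      from nonzero_eq_divide_eq[OF this] show ?thesis using \<epsilon>_def by blast
    qed
    finally show ?thesis .
  qed
  have geo: "(\<lambda>k. (1/2::real) ^ Suc (Suc k)) sums (1/2)"
    using sums_mult[OF geometric_sums[of "1/2::real"], of "1/4"] by simp
  have snt: "summable (\<lambda>k. norm (t k))"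
    by (rule summable_comparison_test'[OF sums_summable[OF geo], of 0]) (use nt in simp)
  define T where "T = (\<Sum>k. t k)"
  have T: "t sums T" unfolding T_def by (rule summable_sums[OF summable_norm_cancel[OF snt]])
  have "norm T \<le> (\<Sum>k. norm (t k))" unfolding T_def by (rule summable_norm[OF snt])
  also have "\<dots> \<le> (\<Sum>k. (1/2) ^ Suc (Suc k))" by (rule suminf_le[OF nt snt sums_summable[OF geo]])
  also have "\<dots> = 1/2" using geo by (rule sums_unique[symmetric])
  finally have nT: "norm T \<le> 1/2" .
  have aY: "(Y k)\<^sup>\<star> = Y k" for k by (simp add: Y_def adj_sum adj_mult adj_adj)
  have at: "(t k)\<^sup>\<star> = t k" for k by (simp add: t_def adj_mult adj aY mult.assoc)
  have aT: "T\<^sup>\<star> = T" using bounded_linear.sums[OF bounded_linear_adj T] T by (simp add: at sums_unique2)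
  have "(\<lambda>k. b * t k * b) sums (b * T * b)" by (intro sums_mult sums_mult2 T)
  then have Ysums: "Y sums (b * T * b)" by (simp add: btb)
  define z where "z p = (case prod_decode p of (k, i) \<Rightarrow> if i < N k then w k i else 0)" for p
  have zz: "(z p)\<^sup>\<star> * z p = (case prod_decode p of (k, i) \<Rightarrow> if i < N k then (w k i)\<^sup>\<star> * w k i else 0)"
    "z p * (z p)\<^sup>\<star> = (case prod_decode p of (k, i) \<Rightarrow> if i < N k then w k i * (w k i)\<^sup>\<star> else 0)" for p
    by (simp_all add: z_def split: prod.split)
  have "(\<lambda>p. (z p)\<^sup>\<star> * z p) sums (b * b)"
    unfolding zz by (rule sums_flatten) (simp_all add: w(1) dsums norm_adj_mult_self abs)
  moreover have "(\<lambda>p. z p * (z p)\<^sup>\<star>) sums (b * T * b)"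
    unfolding zz
  proof (rule sums_flatten)
    show "(\<lambda>k. \<Sum>i<N k. w k i * (w k i)\<^sup>\<star>) sums (b * T * b)" using Ysums by (simp add: Y_def[abs_def])
    have "norm (w k i * (w k i)\<^sup>\<star>) = norm (w k i) * norm (w k i)" for k i
      using norm_adj_mult_self[of "(w k i)\<^sup>\<star>"] by (simp add: adj_adj)
    then show "summable (\<lambda>k. \<Sum>i<N k. norm (w k i * (w k i)\<^sup>\<star>))" using abs by simp
  qed
  ultimately show ?thesis using that nT aT by blast
qed

text \<open>The difference b b - b T b is the square of (1 - q) b, where (1 - q)^2 = 1 - T, so the
  order relation holds with an explicit witness. Finiteness would then force b b = b T b, against
  \<open>norm T \<le> 1 / 2\<close>.\<close>

lemma purely_infinite_not_cp_finite:
  fixes b :: "'a::cstar_algebra"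
  assumes pinf: "purely_infinite TYPE('a)" and b: "b\<^sup>\<star> = b" and b1: "norm b < 1" and "b \<noteq> 0"
  shows "\<not> cp_finite (b * b)"
proof
  assume fin: "cp_finite (b * b)"
  obtain z T where z: "(\<lambda>k. (z k)\<^sup>\<star> * z k) sums (b * b)" "(\<lambda>k. z k * (z k)\<^sup>\<star>) sums (b * T * b)"
    and T: "T\<^sup>\<star> = T" "norm T \<le> 1 / 2"
    using purely_infinite_small_equivalent[OF pinf b b1] by blast
  have T1: "norm T < 1" using T by linarith
  obtain q where q: "q\<^sup>\<star> = q" "q + q = T + q * q" "norm q \<le> 1"
    and "\<And>b. b * T = T * b \<Longrightarrow> b * q = q * b" and "\<And>u. u * T = T \<Longrightarrow> u * q = q"
    by (rule sqrt_one_minus_exists[OF T(1) T1], rule that)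
  have qq: "q * b + q * b = T * b + q * (q * b)"
    using arg_cong[OF q(2), of "\<lambda>z. z * b"] by (simp add: distrib_right mult.assoc)
  have "(b - q * b)\<^sup>\<star> * (b - q * b) = b * (b - (q * b + q * b) + q * (q * b))"
    by (simp add: adj_diff adj_mult b q(1) algebra_simps)
  also have "\<dots> = b * b - b * T * b" unfolding qq by (simp add: algebra_simps)
  finally have "b * T * b \<le>\<^sub>A b * b" unfolding cstar_le_def positive_cone_def by (metis (mono_tags) mem_Collect_eq)
  with fin z have eq: "b * b = b * T * b" unfolding cp_finite_def by blast
  have "norm b * norm b = norm (b * T * b)" using norm_square_selfadj[OF b] eq by simp
  also have "\<dots> \<le> norm b * norm T * norm b"
    by (intro order.trans[OF norm_mult_ineq] mult_right_mono norm_mult_ineq) simp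
  also have "\<dots> \<le> norm b * (1/2) * norm b" by (intro mult_right_mono mult_left_mono T) auto
  finally show False using \<open>b \<noteq> 0\<close> by simp
qed

text \<open>Sequences for the multiple of \<open>x\<close> are sequences for \<open>x\<close>
  rescaled by \<open>r\<close>. It serves to bring the square root of \<open>x\<close> below norm 1,
  where the calculus applies.\<close>

lemma cp_finite_scaleR:
  fixes x :: "'a::cstar_algebra"
  assumes fin: "cp_finite x" and "r \<noteq> 0"
  shows "cp_finite ((r * r) *\<^sub>R x)"
  unfolding cp_finite_def
proof (intro allI impI)
  fix z y
  assume z: "(\<lambda>k. (z k)\<^sup>\<star> * z k) sums ((r * r) *\<^sub>R x)" "(\<lambda>k. z k * (z k)\<^sup>\<star>) sums y"
    and le: "y \<le>\<^sub>A (r * r) *\<^sub>R x"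
  let ?i = "inverse r"
  have i: "?i * ?i * (r * r) = 1" using \<open>r \<noteq> 0\<close> by (simp add: field_simps)
  have "(\<lambda>k. (?i *\<^sub>R z k)\<^sup>\<star> * (?i *\<^sub>R z k)) sums x"
    using sums_scaleR_right[OF z(1), of "?i * ?i"] by (simp add: adj_scaleR i)
  moreover have "(\<lambda>k. (?i *\<^sub>R z k) * (?i *\<^sub>R z k)\<^sup>\<star>) sums ((?i * ?i) *\<^sub>R y)"
    using sums_scaleR_right[OF z(2), of "?i * ?i"] by (simp add: adj_scaleR)
  moreover have "(?i * ?i) *\<^sub>R y \<le>\<^sub>A x"
  proof -
    obtain c where "(r * r) *\<^sub>R x - y = c\<^sup>\<star> * c" using le by (auto simp: cstar_le_def positive_cone_def)
    then have "x - (?i * ?i) *\<^sub>R y = (?i *\<^sub>R c)\<^sup>\<star> * (?i *\<^sub>R c)"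
      by (simp add: adj_scaleR scaleR_diff_right i i[unfolded mult.assoc] flip: \<open>_ = c\<^sup>\<star> * c\<close>)
    then show ?thesis unfolding cstar_le_def positive_cone_def by blast
  qed
  ultimately have "x = (?i * ?i) *\<^sub>R y"
    by (rule fin[unfolded cp_finite_def, rule_format])
  then show "(r * r) *\<^sub>R x = y" using \<open>r \<noteq> 0\<close> by (simp add: field_simps)
qed

theorem proposition4p13:
  assumes "purely_infinite TYPE('a::cstar_algebra)"
  shows "type_III TYPE('a)"
  unfolding type_III_def
proof
  assume "\<exists>x\<in>positive_cone :: 'a set. x \<noteq> 0 \<and> cp_finite x"
  then obtain x :: 'a where x: "x \<in> positive_cone" "x \<noteq> 0" "cp_finite x" by blast
  obtain b where b: "b\<^sup>\<star> = b" "x = b * b" using positive_cone_square[OF x(1)] by blast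
  define r where "r = inverse (norm b + 1)"
  have pos: "0 < norm b + 1" by (rule add_nonneg_pos) auto
  then have r: "0 < r" by (simp add: r_def)
  have "norm (r *\<^sub>R b) < 1" using pos by (simp add: r_def abs_of_pos field_simps)
  moreover have "(r *\<^sub>R b)\<^sup>\<star> = r *\<^sub>R b" "r *\<^sub>R b \<noteq> 0" using b x(2) r by (auto simp: adj_scaleR)
  ultimately have "\<not> cp_finite ((r *\<^sub>R b) * (r *\<^sub>R b))"
    using purely_infinite_not_cp_finite[OF assms] by blast
  moreover have "cp_finite ((r *\<^sub>R b) * (r *\<^sub>R b))"
    using cp_finite_scaleR[OF x(3), of r] r by (simp add: b(2))
  ultimately show False by contradiction
qed

end
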